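(* For every non-empty matroid $M$ without loops or coloops and every integer $k\ge 0$, let $R(M,k)\in\mathbb{Z}[t]$ be the output of the following recursive algorithm: $$\begin{aligned} R(M,k)={}&-\mu(\emptyset,M)\,Q^{(1)}_{k-1,\,\ell(M)-1}(t)\\ &-\sum_{A}\mu(A,M)\Big( T_A + \sum_{k'=1}^{\min\{k-1,\mathrm{rk}(A)-1\}} R(M|A,k')\,Q^{(2)}_{k-1-k',\,\ell(M)-\ell(A)}(t)\Big),\end{aligned}$$ where $A$ runs over all cyclic flats of $M$ with $A\ne\emptyset$ and $A\neq M$, where $\mu$ is the Möbius function of the lattice of cyclic flats of $M$, and where $T_A=R(M|A,k)$ if $k\le\mathrm{rk}(A)$, and $T_A=R(M|A,\mathrm{rk}(A))\cdot Q^{(1)}_{k-\mathrm{rk}(A),\,\ell(M)-\ell(A)-1}(t)$ if $k>\mathrm{rk}(A)$. Then this algorithm computes the function $\bar g_M^{<k}(t)$, that is, $$R(M,k)=\bar g_M^{<k}(t).$$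
   Context: Matroids are finite; $\ell(A)=|A|-\mathrm{rk}(A)$; $M|A$ is the restriction. A subset $A$ of $M$ is a flat if $\mathrm{rk}(A\cup\{e\})=\mathrm{rk}(A)+1$ for all $e\notin A$, and cyclic if $\mathrm{rk}(A\setminus\{e\})=\mathrm{rk}(A)$ for all $e\in A$. The cyclic flats of $M$, ordered by inclusion, form a lattice $\mathcal{Z}_M$; if $M$ has no loops or coloops its minimum is $\emptyset$ and its maximum is the ground set, also denoted $M$. A restriction $M|A$ to a cyclic flat $A$ again has no loops or coloops, and its cyclic flats are those of $M$ contained in $A$. Polynomials: $Q^{(1)}_{r,l}(t)=\sum_{i=0}^{\min\{r,l\}}\binom{r}{i}\binom{l}{i}t^i$ and $Q^{(2)}_{r,l}(t)=\sum_{i=1}^{\min\{r+1,l\}}\binom{r}{i-1}\binom{l}{i}t^i$. Empty sums are $0$. Chain lattice: for a lattice $\mathcal{L}$ with minimum $0$ and maximum $1$, $\mathscr{C}(\mathcal{L})$ consists of all chains $C_\bullet=(C_0<C_1<\dots<C_r)$ in $\mathcal{L}$ with $C_0=0$, $C_r=1$, ordered by refinement ($C_\bullet\le D_\bullet$ if every $C_i$ appears in $D_\bullet$), together with an extra element $1_{\mathscr{C}}$ declared to be the maximum. $\mu_{\mathscr{C}(\mathcal{L})}$ is its Möbius function. Lattice paths: a word in the letters $\mathsf{N}=(0,1)$ and $\mathsf{E}=(1,0)$ is a lattice path starting at $(0,0)$. For a lattice path $P$ from $(0,0)$ to $(\ell,r)$, $\square(P)$ is the set of integer points $(x,y)$ with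 $1\le x<\ell$, $1\le y<r$ that lie strictly below $P$ (i.e. $y<\min\{y' : (x,y')\in P\}$). For integers $i,k\ge0$, let $N_i^{<k}(P)$ be the number of sets $\{(x_1,y_1),\dots,(x_i,y_i)\}\subseteq\square(P)$ with $x_1<\dots<x_i$ and $y_1<\dots<y_i<k$ (so $N_0^{<k}(P)=1$). For a chain $C_\bullet=(\emptyset=C_0<\dots<C_r=M)$ of cyclic flats of $M$, let $P(C_\bullet)$ be the path $\mathsf{N}^{\mathrm{rk}(C_1)}\mathsf{E}^{\ell(C_1)}\mathsf{N}^{\mathrm{rk}(C_2)-\mathrm{rk}(C_1)}\mathsf{E}^{\ell(C_2)-\ell(C_1)}\cdots\mathsf{N}^{\mathrm{rk}(C_r)-\mathrm{rk}(C_{r-1})}\mathsf{E}^{\ell(C_r)-\ell(C_{r-1})}$. Define $$\bar g_M^{<k}(t)=\sum_{C_\bullet\in\mathscr{C}(\mathcal{Z}_M),\,C_\bullet\ne1_{\mathscr{C}}}\big(-\mu_{\mathscr{C}(\mathcal{Z}_M)}(C_\bullet,1_{\mathscr{C}})\big)\sum_{i=0}^{\mathrm{rk}(M)-1}t^i\,N_i^{<k}(P(C_\bullet)).$$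
   Formalization: The identity is proved for 1 ≤ k ≤ rk(M) instead of every integer k ≥ 0: at k = 0 it fails for every M (R(M,0) = 0, while the function equals 1), and for k > rk(M) it fails in general (U_{2,4}, k = 3: 1+2t versus 1+t). *)

theory Defs
  imports
    "HOL-Computational_Algebra.Polynomial"
    "HOL-Library.Lattice_Constructions"
begin

section \<open>Finite matroids\<close>

typedef 'a matroid =
  "{(E, I) :: 'a set \<times> 'a set set | E I.
      finite E \<and> (\<forall>X\<in>I. X \<subseteq> E) \<and> {} \<in> I \<and>
      (\<forall>X\<in>I. \<forall>Y. Y \<subseteq> X \<longrightarrow> Y \<in> I) \<and>
      (\<forall>X\<in>I. \<forall>Y\<in>I. card X < card Y \<longrightarrow> (\<exists>e\<in>Y - X. insert e X \<in> I))}"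
  by (rule exI[of _ "({}, {{}})"]) auto

definition ground :: "'a matroid \<Rightarrow> 'a set" where
  "ground M = fst (Rep_matroid M)"

definition indeps :: "'a matroid \<Rightarrow> 'a set set" where
  "indeps M = snd (Rep_matroid M)"

definition rk :: "'a matroid \<Rightarrow> 'a set \<Rightarrow> nat" where
  "rk M A = Max (card ` {X \<in> indeps M. X \<subseteq> A})"

definition nullity :: "'a matroid \<Rightarrow> 'a set \<Rightarrow> nat" where
  "nullity M A = card A - rk M A"

definition restriction :: "'a matroid \<Rightarrow> 'a set \<Rightarrow> 'a matroid" where
  "restriction M A = Abs_matroid (ground M \<inter> A, {X \<in> indeps M. X \<subseteq> A})"

lemma finite_ground: "finite (ground M)"
  using Rep_matroid[of M] by (auto simp: ground_def)

lemma restriction_in_matroid: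
  "(ground M \<inter> A, {X \<in> indeps M. X \<subseteq> A}) \<in>
   {(E, I) :: 'a set \<times> 'a set set | E I.
      finite E \<and> (\<forall>X\<in>I. X \<subseteq> E) \<and> {} \<in> I \<and>
      (\<forall>X\<in>I. \<forall>Y. Y \<subseteq> X \<longrightarrow> Y \<in> I) \<and>
      (\<forall>X\<in>I. \<forall>Y\<in>I. card X < card Y \<longrightarrow> (\<exists>e\<in>Y - X. insert e X \<in> I))}"
proof -
  obtain E I where EI: "Rep_matroid M = (E, I)" by (cases "Rep_matroid M")
  have r: "finite E" "\<forall>X\<in>I. X \<subseteq> E" "{} \<in> I" "\<forall>X\<in>I. \<forall>Y. Y \<subseteq> X \<longrightarrow> Y \<in> I"
    "\<forall>X\<in>I. \<forall>Y\<in>I. card X < card Y \<longrightarrow> (\<exists>e\<in>Y - X. insert e X \<in> I)"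
    using Rep_matroid[of M] EI by auto
  have "\<exists>e\<in>Y - X. insert e X \<in> {X \<in> I. X \<subseteq> A}"
    if XY: "X \<in> I" "X \<subseteq> A" "Y \<in> I" "Y \<subseteq> A" "card X < card Y" for X Y
  proof -
    obtain e where "e \<in> Y - X" "insert e X \<in> I" using r(5) XY by blast
    then show ?thesis using XY by blast
  qed
  then show ?thesis using r EI by (auto simp: ground_def indeps_def)
qed

lemma ground_restriction [simp]: "ground (restriction M A) = ground M \<inter> A"
  unfolding restriction_def ground_def[of "Abs_matroid _"]
  by (subst Abs_matroid_inverse[OF restriction_in_matroid]) simp

lemma indeps_restriction [simp]: "indeps (restriction M A) = {X \<in> indeps M. X \<subseteq> A}"
  unfolding restriction_def indeps_def[of "Abs_matroid _"]
  by (subst Abs_matroid_inverse[OF restriction_in_matroid]) simp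

definition loop :: "'a matroid \<Rightarrow> 'a \<Rightarrow> bool" where
  "loop M e \<longleftrightarrow> e \<in> ground M \<and> {e} \<notin> indeps M"

definition basis :: "'a matroid \<Rightarrow> 'a set \<Rightarrow> bool" where
  "basis M B \<longleftrightarrow> B \<in> indeps M \<and> (\<forall>X\<in>indeps M. B \<subseteq> X \<longrightarrow> X = B)"

definition coloop :: "'a matroid \<Rightarrow> 'a \<Rightarrow> bool" where
  "coloop M e \<longleftrightarrow> e \<in> ground M \<and> (\<forall>B. basis M B \<longrightarrow> e \<in> B)"

definition flat :: "'a matroid \<Rightarrow> 'a set \<Rightarrow> bool" where
  "flat M A \<longleftrightarrow> A \<subseteq> ground M \<and> (\<forall>e\<in>ground M - A. rk M (A \<union> {e}) = rk M A + 1)"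

definition cyclic :: "'a matroid \<Rightarrow> 'a set \<Rightarrow> bool" where
  "cyclic M A \<longleftrightarrow> A \<subseteq> ground M \<and> (\<forall>e\<in>A. rk M (A - {e}) = rk M A)"

definition cyclic_flats :: "'a matroid \<Rightarrow> 'a set set" where
  "cyclic_flats M = {A. flat M A \<and> cyclic M A}"

lemma cyclic_flats_subset: "A \<in> cyclic_flats M \<Longrightarrow> A \<subseteq> ground M"
  by (simp add: cyclic_flats_def flat_def)


section \<open>Moebius functions\<close>

text \<open>The Moebius function of the subset \<open>P\<close> of an ordered type, with the induced order.
  The finiteness test only serves termination; it holds on every finite \<open>P\<close>.\<close>

function moebius :: "'b::order set \<Rightarrow> 'b \<Rightarrow> 'b \<Rightarrow> int" where
  "moebius P x y =
    (if x = y then 1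
     else if x < y \<and> finite {z \<in> P. x \<le> z \<and> z < y}
       then - (\<Sum>z\<in>{z \<in> P. x \<le> z \<and> z < y}. moebius P x z)
     else 0)"
  by pat_completeness auto
termination
proof (relation "measure (\<lambda>(P, x, y). card {z \<in> P. x \<le> z \<and> z < y})")
  fix P :: "'b::order set" and x y z :: 'b
  assume fin: "x < y \<and> finite {z \<in> P. x \<le> z \<and> z < y}"
    and z: "z \<in> {z \<in> P. x \<le> z \<and> z < y}"
  have "{w \<in> P. x \<le> w \<and> w < z} \<subset> {w \<in> P. x \<le> w \<and> w < y}"
    using z by auto
  then show "((P, x, z), (P, x, y)) \<in> measure (\<lambda>(P, x, y). card {z \<in> P. x \<le> z \<and> z < y})"
    using fin by (simp add: psubset_card_mono)
qed simp

declare moebius.simps [simp del]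

text \<open>A chain \<open>C\<^sub>0 < \<dots> < C\<^sub>r\<close> is encoded as the set of its members, so that refinement of
  chains is set inclusion; the additional maximum is \<open>Top\<close>. The order on the type
  \<open>'b set top\<close> is then exactly the order of the chain lattice. The parameters \<open>a\<close> and \<open>b\<close> are
  the minimum and the maximum of the lattice \<open>L\<close>.\<close>

definition bounded_chains :: "'b::order set \<Rightarrow> 'b \<Rightarrow> 'b \<Rightarrow> 'b set set" where
  "bounded_chains L a b =
    {C. C \<subseteq> L \<and> finite C \<and> Complete_Partial_Order.chain (\<le>) C \<and> a \<in> C \<and> b \<in> C}"

definition chain_lattice :: "'b::order set \<Rightarrow> 'b \<Rightarrow> 'b \<Rightarrow> 'b set top set" where
  "chain_lattice L a b = top.Value ` bounded_chains L a b \<union> {top.Top}"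


section \<open>Lattice paths\<close>

datatype step = North | East

text \<open>The integer points on a path starting at the origin.\<close>

definition path_points :: "step list \<Rightarrow> (nat \<times> nat) set" where
  "path_points P =
    {(count_list (take j P) East, count_list (take j P) North) | j. j \<le> length P}"

definition points_below :: "step list \<Rightarrow> (nat \<times> nat) set" where
  "points_below P =
    {(x, y). 1 \<le> x \<and> x < count_list P East \<and> 1 \<le> y \<and> y < count_list P North \<and>
             y < Min {y'. (x, y') \<in> path_points P}}"

definition num_chains_below :: "nat \<Rightarrow> nat \<Rightarrow> step list \<Rightarrow> nat" where
  "num_chains_below i k P =
    card {S. S \<subseteq> points_below P \<and>
             (\<exists>x y. S = (\<lambda>j. (x j, y j)) ` {1..i} \<and>
                    strict_mono_on {1..i} x \<and> strict_mono_on {1..i} y \<and>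
                    (\<forall>j\<in>{1..i}. y j < k))}"

fun path_of_list :: "'a matroid \<Rightarrow> 'a set list \<Rightarrow> step list" where
  "path_of_list M (A # B # Cs) =
     replicate (rk M B - rk M A) North @ replicate (nullity M B - nullity M A) East @
     path_of_list M (B # Cs)"
| "path_of_list M _ = []"

definition chain_path :: "'a matroid \<Rightarrow> 'a set set \<Rightarrow> step list" where
  "chain_path M C = path_of_list M (THE Cs. sorted_wrt (\<subset>) Cs \<and> set Cs = C)"


section \<open>The function computed by counting points below lattice paths\<close>

definition gbar :: "'a matroid \<Rightarrow> nat \<Rightarrow> int poly" where
  "gbar M k =
    (\<Sum>C\<in>bounded_chains (cyclic_flats M) {} (ground M).
       smult (- moebius (chain_lattice (cyclic_flats M) {} (ground M)) (top.Value C) top.Top)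
         (\<Sum>i<rk M (ground M). monom (int (num_chains_below i k (chain_path M C))) i))"


section \<open>The recursive algorithm\<close>

text \<open>The index \<open>k - 1\<close> equals \<open>-1\<close> for \<open>k = 0\<close>, hence integer indices; the sums
  are empty when the upper limit is negative.\<close>

definition Q1 :: "int \<Rightarrow> int \<Rightarrow> int poly" where
  "Q1 r l = (\<Sum>i | int i \<le> min r l. monom (int ((nat r choose i) * (nat l choose i))) i)"

definition Q2 :: "int \<Rightarrow> int \<Rightarrow> int poly" where
  "Q2 r l = (\<Sum>i | 1 \<le> i \<and> int i \<le> min (r + 1) l.
               monom (int ((nat r choose (i - 1)) * (nat l choose i))) i)"

text \<open>For a non-empty matroid \<open>M\<close> without loops and coloops, \<open>R M k\<close> agrees with \<open>gbar M k\<close>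
  in the range \<open>1 \<le> k \<le> rk M (ground M)\<close>, which the recursion does not leave. Outside this
  range it need not: \<open>R M 0 = 0\<close> while \<open>gbar M 0 = 1\<close>, and for the uniform matroid of
  rank 2 on 4 elements \<open>R M 3 = 1 + 2t\<close> while \<open>gbar M 3 = 1 + t\<close>.\<close>

function R :: "'a matroid \<Rightarrow> nat \<Rightarrow> int poly" where
  "R M k =
     smult (- moebius (cyclic_flats M) {} (ground M))
       (Q1 (int k - 1) (int (nullity M (ground M)) - 1))
     - (\<Sum>A\<in>cyclic_flats M - {{}, ground M}.
          smult (moebius (cyclic_flats M) A (ground M))
            ((if k \<le> rk M A then R (restriction M A) k
              else R (restriction M A) (rk M A) *
                   Q1 (int k - int (rk M A)) (int (nullity M (ground M)) - int (nullity M A) - 1))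
             + (\<Sum>k'\<in>{1..min (k - 1) (rk M A - 1)}.
                  R (restriction M A) k' *
                  Q2 (int k - 1 - int k') (int (nullity M (ground M)) - int (nullity M A)))))"
  by pat_completeness auto
termination
proof -
  have *: "((restriction M A, k'), (M, k)) \<in> measure (\<lambda>(M, k). card (ground M))"
    if "A \<in> cyclic_flats M - {{}, ground M}" for M :: "'a matroid" and A k k'
  proof -
    have "ground M \<inter> A \<subset> ground M" using that cyclic_flats_subset by blast
    then show ?thesis using finite_ground[of M] by (simp add: psubset_card_mono)
  qed
  show ?thesis
    by (relation "measure (\<lambda>(M, k). card (ground M))") (simp, (erule *)+)
qed

declare R.simps [simp del]

end

theory Submission
  imports Defs "HOL-Library.Infinite_Set"
begin

text \<open>
  The function \<open>gbar\<close> satisfies the recursion that defines \<open>R\<close>, and both recursions descend to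
  restrictions with smaller ground sets. Two independent facts give the recursion of \<open>gbar\<close>.

  The weights factor. Below its extra maximum the chain lattice is locally Boolean, so the weight
  \<open>- \<mu>(C, 1)\<close> of a chain is the signed count of its refinements (\<open>moebius_chain_lattice_Top\<close>).
  If \<open>A\<close> is the last member of \<open>C\<close> below the ground set, a refinement of \<open>C\<close> consists of a
  refinement of the part up to \<open>A\<close> and a chain from \<open>A\<close> to the ground set. By Philip Hall's theorem
  the weight is therefore \<open>- \<mu>(A, M)\<close> times the weight of the part up to \<open>A\<close>, taken in \<open>M|A\<close>
  (\<open>chain_weight_insert_top\<close>).

  The counts split. The path of \<open>C\<close> is the path of the part up to \<open>A\<close> followed by north steps and
  then east steps. The points below it are the points below the shorter path, together with the
  points below height \<open>rk A\<close> on the line \<open>x = nullity A\<close> and a block of full columns to its right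
  (\<open>points_below_append_corner\<close>). A chain of points is cut along this line, and the chains are
  grouped by the lowest height \<open>k'\<close> of their right part. The left part then is an arbitrary chain
  with heights less than \<open>k'\<close>, and the right parts are chains in a grid. Such a chain is a pair of
  equinumerous sets of abscissae and heights, which is why \<open>Q2\<close> counts those with lowest height
  \<open>k'\<close>. Right parts that are empty or start at height \<open>rk A\<close> or above do not constrain the left part;
  they give the terms with \<open>k \<le> rk A\<close> and \<open>k > rk A\<close>, the latter with the factor \<open>Q1\<close>
  (\<open>chain_poly_append_corner\<close>).
\<close>

section \<open>Rank and cyclic flats\<close>

lemma
  shows indep_subset_ground: "X \<in> indeps M \<Longrightarrow> X \<subseteq> ground M"
    and indep_empty: "{} \<in> indeps M"
    and indep_subset: "X \<in> indeps M \<Longrightarrow> Y \<subseteq> X \<Longrightarrow> Y \<in> indeps M"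
    and indep_augment: "X \<in> indeps M \<Longrightarrow> Y \<in> indeps M \<Longrightarrow> card X < card Y \<Longrightarrow>
      \<exists>e\<in>Y - X. insert e X \<in> indeps M"
proof -
  obtain E I where EI: "Rep_matroid M = (E, I)" by (cases "Rep_matroid M")
  show "X \<in> indeps M \<Longrightarrow> X \<subseteq> ground M" "{} \<in> indeps M"
    "X \<in> indeps M \<Longrightarrow> Y \<subseteq> X \<Longrightarrow> Y \<in> indeps M"
    "X \<in> indeps M \<Longrightarrow> Y \<in> indeps M \<Longrightarrow> card X < card Y \<Longrightarrow>
      \<exists>e\<in>Y - X. insert e X \<in> indeps M"
    using Rep_matroid[of M] unfolding ground_def indeps_def EI by auto
qed

lemma indep_finite: "X \<in> indeps M \<Longrightarrow> finite X"
  using indep_subset_ground finite_ground finite_subset by metis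

lemma finite_indeps_within: "finite {X \<in> indeps M. X \<subseteq> A}"
  by (rule finite_subset[of _ "Pow (ground M)"]) (auto dest: indep_subset_ground simp: finite_ground)

lemma card_le_rk: "X \<in> indeps M \<Longrightarrow> X \<subseteq> A \<Longrightarrow> card X \<le> rk M A"
  unfolding rk_def by (rule Max_ge) (auto simp: finite_indeps_within)

lemma ex_indep_card_rk:
  obtains X where "X \<in> indeps M" "X \<subseteq> A" "card X = rk M A"
proof -
  have "rk M A \<in> card ` {X \<in> indeps M. X \<subseteq> A}"
    unfolding rk_def using finite_indeps_within indep_empty by (intro Max_in) blast+
  then show thesis using that by auto
qed

lemma rk_mono: "A \<subseteq> B \<Longrightarrow> rk M A \<le> rk M B"
  by (metis card_le_rk ex_indep_card_rk order_trans)

lemma rk_empty [simp]: "rk M {} = 0"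
  by (rule ex_indep_card_rk[of M "{}"]) simp

lemma rk_le_card: "finite A \<Longrightarrow> rk M A \<le> card A"
  by (metis card_mono ex_indep_card_rk)

lemma rk_insert_le: "rk M (insert e A) \<le> rk M A + 1"
proof -
  obtain X where X: "X \<in> indeps M" "X \<subseteq> insert e A" "card X = rk M (insert e A)"
    by (rule ex_indep_card_rk)
  have "X - {e} \<in> indeps M" using X(1) by (rule indep_subset) auto
  then have "card (X - {e}) \<le> rk M A"
    using X(2) by (intro card_le_rk) auto
  moreover have "card X \<le> card (X - {e}) + 1"
    using card.remove[OF indep_finite[OF X(1)], of e] by (cases "e \<in> X") auto
  ultimately show ?thesis using X by simp
qed

lemma indep_extend:
  assumes "X \<in> indeps M" "X \<subseteq> A"
  shows "\<exists>Y\<in>indeps M. X \<subseteq> Y \<and> Y \<subseteq> A \<and> card Y = rk M A"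
  using assms
proof (induction "rk M A - card X" arbitrary: X)
  case 0
  then have "card X = rk M A" using card_le_rk[of X M A] by simp
  then show ?case using 0 by blast
next
  case (Suc n)
  obtain W where W: "W \<in> indeps M" "W \<subseteq> A" "card W = rk M A" by (rule ex_indep_card_rk)
  have "card X < card W" using Suc.hyps(2) W(3) by linarith
  then obtain e where e: "e \<in> W - X" "insert e X \<in> indeps M"
    using indep_augment[OF Suc.prems(1) W(1)] by blast
  have "card (insert e X) = Suc (card X)" using e Suc.prems indep_finite[of X M] by auto
  then have "n = rk M A - card (insert e X)" "insert e X \<subseteq> A"
    using Suc.hyps(2) Suc.prems e W by auto
  from Suc.hyps(1)[OF this(1) e(2) this(2)] show ?case by auto
qed

text \<open>Diminishing returns, the consequence of submodularity that is needed: a basis of \<open>X\<close>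
  extends to a basis of \<open>A\<close>, so an element that raises the rank of \<open>A\<close> raises that of \<open>X\<close>.\<close>

lemma rk_insert_eq_mono:
  assumes "X \<subseteq> A" and "rk M (insert e X) = rk M X"
  shows "rk M (insert e A) = rk M A"
proof (rule ccontr)
  assume "rk M (insert e A) \<noteq> rk M A"
  then have r: "rk M A < rk M (insert e A)" using rk_mono[OF subset_insertI, of M A e] by linarith
  obtain B where B: "B \<in> indeps M" "B \<subseteq> X" "card B = rk M X" by (rule ex_indep_card_rk)
  obtain C where C: "C \<in> indeps M" "B \<subseteq> C" "C \<subseteq> A" "card C = rk M A"
    using indep_extend[of B M A] B assms(1) by blast
  obtain D where D: "D \<in> indeps M" "C \<subseteq> D" "D \<subseteq> insert e A" "card D = rk M (insert e A)"
    using indep_extend[of C M "insert e A"] C by blast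
  have eD: "e \<in> D" using D r card_le_rk[of D M A] by auto
  have "e \<notin> A" using r by (auto simp: insert_absorb)
  then have "e \<notin> B" using B assms(1) by auto
  have "insert e B \<in> indeps M" using D(1) by (rule indep_subset) (use D C eD in auto)
  then have "card (insert e B) \<le> rk M (insert e X)" using B by (intro card_le_rk) auto
  then show False using \<open>e \<notin> B\<close> B assms(2) indep_finite[OF B(1)] by simp
qed

lemma rk_restriction: "X \<subseteq> A \<Longrightarrow> rk (restriction M A) X = rk M X"
  unfolding rk_def by (auto intro!: arg_cong[of _ _ Max] arg_cong[of _ _ "image card"])

lemma nullity_restriction: "X \<subseteq> A \<Longrightarrow> nullity (restriction M A) X = nullity M X"
  by (simp add: nullity_def rk_restriction)

lemma cyclic_flatsD:
  assumes "A \<in> cyclic_flats M"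
  shows "A \<subseteq> ground M" "finite A" "e \<in> ground M - A \<Longrightarrow> rk M (insert e A) = rk M A + 1"
    "e \<in> A \<Longrightarrow> rk M (A - {e}) = rk M A"
  using assms finite_subset[OF _ finite_ground[of M]]
  by (auto simp: cyclic_flats_def flat_def cyclic_def)

lemma finite_cyclic_flats: "finite (cyclic_flats M)"
  by (rule finite_subset[of _ "Pow (ground M)"]) (auto dest: cyclic_flats_subset simp: finite_ground)

text \<open>A flat \<open>X\<close> of \<open>M|A\<close> is a flat of \<open>M\<close>: an element outside the flat \<open>A\<close> raises the rank of
  \<open>A\<close>, hence by diminishing returns that of \<open>X\<close>.\<close>

lemma cyclic_flats_restriction:
  assumes A: "A \<in> cyclic_flats M"
  shows "cyclic_flats (restriction M A) = cyclic_flats M \<inter> {{}..A}"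
proof -
  have AE: "A \<subseteq> ground M" using cyclic_flatsD(1)[OF A] .
  have cyc: "cyclic (restriction M A) X \<longleftrightarrow> cyclic M X" if "X \<subseteq> A" for X
  proof -
    have "rk (restriction M A) (X - {e}) = rk M (X - {e})" for e
      using that by (intro rk_restriction) auto
    then show ?thesis using that AE by (auto simp: cyclic_def rk_restriction)
  qed
  have flt: "flat (restriction M A) X \<longleftrightarrow> flat M X" if X: "X \<subseteq> A" for X
  proof -
    have 1: "rk (restriction M A) (insert e X) = rk M (insert e X)" if "e \<in> A" for e
      using that X by (intro rk_restriction) auto
    have 2: "rk M (insert e X) = rk M X + 1" if e: "e \<in> ground M - A" for e
    proof -
      have "rk M (insert e X) \<noteq> rk M X"
        using rk_insert_eq_mono[OF X, of M e] cyclic_flatsD(3)[OF A e] by auto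
      then show ?thesis using rk_insert_le[of M e X] rk_mono[OF subset_insertI, of M X e] by linarith
    qed
    show ?thesis unfolding flat_def using X AE 1 2
      by (simp add: rk_restriction Ball_def) blast
  qed
  have "X \<subseteq> A" if "X \<in> cyclic_flats (restriction M A)" for X
    using cyclic_flatsD(1)[OF that] by auto
  moreover have "X \<in> cyclic_flats (restriction M A) \<longleftrightarrow> X \<in> cyclic_flats M" if "X \<subseteq> A" for X
    using cyc[OF that] flt[OF that] by (simp add: cyclic_flats_def)
  ultimately show ?thesis by fastforce
qed

text \<open>Along a chain of cyclic flats both coordinates increase strictly, the rank because the
  smaller set is a flat and the nullity because the larger set is cyclic. Hence every member of a
  chain other than \<open>{}\<close> ends a genuine corner \<open>N\<dots>NE\<dots>E\<close> of its path.\<close>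

lemma rk_strict_mono_cyclic_flats:
  assumes "A \<in> cyclic_flats M" "B \<in> cyclic_flats M" "A \<subset> B"
  shows "rk M A < rk M B"
proof -
  obtain e where e: "e \<in> B - A" using assms(3) by blast
  then have "rk M (insert e A) = rk M A + 1"
    using cyclic_flatsD(3)[OF assms(1)] cyclic_flatsD(1)[OF assms(2)] by blast
  moreover have "rk M (insert e A) \<le> rk M B" using assms(3) e by (intro rk_mono) auto
  ultimately show ?thesis by simp
qed

lemma nullity_mono:
  assumes "A \<subseteq> B" "finite B"
  shows "nullity M A \<le> nullity M B"
  using assms(1)
proof (induction "card (B - A)" arbitrary: A)
  case 0
  then show ?case using assms(2) by auto
next
  case (Suc n)
  then obtain e where e: "e \<in> B - A" by (metis card.empty ex_in_conv nat.distinct(1))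
  then have "card (B - A) = Suc (card (B - A - {e}))"
    using assms(2) by (intro card.remove) auto
  then have "n = card (B - insert e A)"
    using Suc.hyps(2) by (simp flip: Diff_insert)
  then have "nullity M (insert e A) \<le> nullity M B"
    using e Suc.prems by (intro Suc.hyps(1)) auto
  moreover have "nullity M A \<le> nullity M (insert e A)"
    using e rk_insert_le[of M e A] finite_subset[OF Suc.prems assms(2)]
    by (simp add: nullity_def)
  ultimately show ?case by simp
qed

text \<open>Deleting an element of \<open>B - A\<close> from the cyclic set \<open>B\<close> lowers its nullity and leaves a
  superset of \<open>A\<close>.\<close>

lemma nullity_strict_mono_cyclic_flats:
  assumes "A \<in> cyclic_flats M" "B \<in> cyclic_flats M" "A \<subset> B"
  shows "nullity M A < nullity M B"
proof -
  obtain e where e: "e \<in> B - A" using assms(3) by blast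
  have B: "finite B" "rk M (B - {e}) = rk M B"
    using cyclic_flatsD(2,4)[OF assms(2)] e by auto
  have "nullity M A \<le> nullity M (B - {e})" using e assms(3) B by (intro nullity_mono) auto
  moreover have "rk M (B - {e}) \<le> card (B - {e})" using B by (intro rk_le_card) auto
  moreover have "card B = Suc (card (B - {e}))" using B e by (intro card.remove) auto
  ultimately have "nullity M A < nullity M B" using B by (simp add: nullity_def)
  then show ?thesis .
qed

lemma empty_mem_cyclic_flats:
  assumes "\<forall>e. \<not> loop M e"
  shows "{} \<in> cyclic_flats M"
proof -
  have "rk M {e} = 1" if "e \<in> ground M" for e
    using assms that card_le_rk[of "{e}" M "{e}"] rk_insert_le[of M e "{}"] by (auto simp: loop_def)
  then show ?thesis by (auto simp: cyclic_flats_def flat_def cyclic_def)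
qed

lemma ground_mem_cyclic_flats:
  assumes "\<forall>e. \<not> coloop M e"
  shows "ground M \<in> cyclic_flats M"
proof -
  have "rk M (ground M - {e}) = rk M (ground M)" if e: "e \<in> ground M" for e
  proof -
    obtain B where B: "basis M B" "e \<notin> B" using assms e by (auto simp: coloop_def)
    then have I: "B \<in> indeps M" by (simp add: basis_def)
    obtain Y where "Y \<in> indeps M" "B \<subseteq> Y" "card Y = rk M (ground M)"
      using indep_extend[OF I indep_subset_ground[OF I]] by blast
    then have "card B = rk M (ground M)" using B by (auto simp: basis_def)
    moreover have "card B \<le> rk M (ground M - {e})"
      using B I indep_subset_ground[OF I] by (intro card_le_rk) auto
    ultimately show ?thesis using rk_mono[of "ground M - {e}" "ground M" M] by auto
  qed
  then show ?thesis by (auto simp: cyclic_flats_def flat_def cyclic_def)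
qed

section \<open>Moebius functions and signed counts of chains\<close>

abbreviation chain_of :: "'b::order set \<Rightarrow> bool" where
  "chain_of \<equiv> Complete_Partial_Order.chain (\<le>)"

text \<open>Intersecting with the interval expresses the chains of every interval, and those of the
  cyclic flats of a restriction, within one fixed set \<open>L\<close>.\<close>

abbreviation chains_between :: "'b::order set \<Rightarrow> 'b \<Rightarrow> 'b \<Rightarrow> 'b set set" where
  "chains_between L a b \<equiv> bounded_chains (L \<inter> {a..b}) a b"

lemma finite_bounded_chains: "finite L \<Longrightarrow> finite (bounded_chains L a b)"
  by (rule finite_subset[of _ "Pow L"]) (auto simp: bounded_chains_def)

lemma chains_between_iff:
  "C \<in> chains_between L a b \<longleftrightarrow>
     C \<subseteq> L \<and> (\<forall>x\<in>C. a \<le> x \<and> x \<le> b) \<and> finite C \<and> chain_of C \<and> a \<in> C \<and> b \<in> C"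
  by (auto simp: bounded_chains_def)

lemma finite_chain_greatest:
  fixes C :: "'b::order set"
  assumes "finite C" "C \<noteq> {}" "chain_of C"
  obtains z where "z \<in> C" "\<And>x. x \<in> C \<Longrightarrow> x \<le> z"
proof -
  obtain z where z: "z \<in> C" "\<And>x. x \<in> C \<Longrightarrow> z \<le> x \<Longrightarrow> z = x"
    using finite_has_maximal[OF assms(1,2)] by blast
  then have "x \<le> z" if "x \<in> C" for x
    using chainD[OF assms(3) that z(1)] that by auto
  then show thesis using that z(1) by blast
qed

lemma chain_of_insert_top:
  assumes "chain_of C" "\<And>x. x \<in> C \<Longrightarrow> x \<le> b"
  shows "chain_of (insert b C)"
  using assms by (auto simp: chain_def)

text \<open>A chain from \<open>a\<close> to \<open>b\<close> is a chain from \<open>a\<close> to its last member \<open>z\<close> below \<open>b\<close>, with \<open>b\<close> put on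
  top. This is the source of every recursion below: the one of the Moebius function and the one of
  \<open>gbar\<close>.\<close>

lemma bij_betw_chains_between_remove_top:
  fixes L :: "'b::order set"
  assumes ab: "b \<in> L" "a < b"
  shows "bij_betw (\<lambda>(z, C). insert b C)
    (Sigma {z\<in>L. a \<le> z \<and> z < b} (chains_between L a)) (chains_between L a b)"
    (is "bij_betw _ ?S _")
proof (rule bij_betw_imageI)
  show "inj_on (\<lambda>(z, C). insert b C) ?S"
  proof (rule inj_onI, clarify)
    fix z C z' C'
    assume 1: "C \<in> chains_between L a z" "z < b" and 2: "C' \<in> chains_between L a z'" "z' < b"
      and eq: "insert b C = insert b C'"
    have "b \<notin> C" "b \<notin> C'" using 1 2 by (auto simp: chains_between_iff)
    then have C: "C = C'" using eq by (simp add: insert_ident)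
    moreover have "z \<le> z'" "z' \<le> z" using 1 2 C by (auto simp: chains_between_iff)
    ultimately show "z = z' \<and> C = C'" by simp
  qed
  show "(\<lambda>(z, C). insert b C) ` ?S = chains_between L a b"
  proof (intro equalityI subsetI)
    fix D assume "D \<in> (\<lambda>(z, C). insert b C) ` ?S"
    then obtain z C where zC: "z \<in> L" "z < b" "C \<in> chains_between L a z" "D = insert b C"
      by auto
    have le: "x \<le> b" if "x \<in> C" for x
      using that zC by (auto simp: chains_between_iff intro: order_trans[OF _ less_imp_le])
    then have "chain_of D" unfolding zC(4) using zC(3)
      by (intro chain_of_insert_top) (auto simp: chains_between_iff)
    then show "D \<in> chains_between L a b" using zC ab le by (auto simp: chains_between_iff)
  next
    fix D assume D: "D \<in> chains_between L a b"
    let ?C = "D - {b}"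
    have C: "finite ?C" "?C \<noteq> {}" "chain_of ?C" "a \<in> ?C"
      using D ab by (auto simp: chains_between_iff intro: chain_subset)
    obtain z where z: "z \<in> ?C" "\<And>x. x \<in> ?C \<Longrightarrow> x \<le> z"
      using finite_chain_greatest[OF C(1-3)] by blast
    have "z < b" using z(1) D by (auto simp: chains_between_iff order.strict_iff_order)
    moreover have "?C \<in> chains_between L a z" "z \<in> L" "a \<le> z"
      using D C z by (auto simp: chains_between_iff)
    moreover have "b \<in> D" using D by (simp add: chains_between_iff)
    ultimately show "D \<in> (\<lambda>(z, C). insert b C) ` ?S"
      by (intro image_eqI[where x = "(z, ?C)"]) (simp_all add: insert_absorb)
  qed
qed

lemma sum_chains_between_remove_top:
  fixes L :: "'b::order set"
  assumes L: "finite L" and ab: "b \<in> L" "a < b"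
  shows "(\<Sum>C\<in>chains_between L a b. f C) =
    (\<Sum>z\<in>{z\<in>L. a \<le> z \<and> z < b}. \<Sum>C\<in>chains_between L a z. f (insert b C))"
proof -
  let ?S = "Sigma {z\<in>L. a \<le> z \<and> z < b} (chains_between L a)"
  have "(\<Sum>C\<in>chains_between L a b. f C) = (\<Sum>(z, C)\<in>?S. f (insert b C))"
    using sum.reindex_bij_betw[OF bij_betw_chains_between_remove_top[OF ab], of f]
    by (simp add: case_prod_unfold)
  also have "\<dots> = (\<Sum>z\<in>{z\<in>L. a \<le> z \<and> z < b}. \<Sum>C\<in>chains_between L a z. f (insert b C))"
    using L by (intro sum.Sigma[symmetric]) (auto intro: finite_bounded_chains)
  finally show ?thesis .
qed

lemma chains_between_cases:
  assumes "C \<in> chains_between L a b" "a < b"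
  obtains z C' where "z \<in> L" "a \<le> z" "z < b" "C' \<in> chains_between L a z" "C = insert b C'"
proof -
  have "b \<in> L" using assms by (auto simp: chains_between_iff)
  from bij_betw_imp_surj_on[OF bij_betw_chains_between_remove_top[OF this assms(2)]] assms(1)
  have "C \<in> (\<lambda>(z, C). insert b C) ` Sigma {z\<in>L. a \<le> z \<and> z < b} (chains_between L a)"
    by blast
  then show thesis using that by auto
qed

text \<open>Philip Hall's theorem. Removing the top element of each chain turns the signed chain count
  into the recursion that defines the Moebius function.\<close>

lemma moebius_eq_chain_sum:
  fixes L :: "'b::order set"
  assumes L: "finite L" and "b \<in> L" "a \<le> b"
  shows "moebius L a b = - (\<Sum>C\<in>chains_between L a b. (-1) ^ card C)"
  using assms(2,3)
proof (induction "card {z\<in>L. a \<le> z \<and> z < b}" arbitrary: b rule: less_induct)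
  case less
  show ?case
  proof (cases "a = b")
    case True
    have "C \<in> chains_between L b b \<longleftrightarrow> C = {b}" for C
      unfolding chains_between_iff using less.prems
      by (auto simp: chain_def intro: antisym)
    then have "chains_between L b b = {{b}}" by blast
    then show ?thesis using True by (simp add: moebius.simps)
  next
    case False
    then have ab: "a < b" using less.prems by simp
    let ?Z = "{z\<in>L. a \<le> z \<and> z < b}"
    have fin: "finite ?Z" using L by simp
    have "moebius L a b = - (\<Sum>z\<in>?Z. moebius L a z)"
      using ab fin by (subst moebius.simps) simp
    also have "(\<Sum>z\<in>?Z. moebius L a z)
        = (\<Sum>z\<in>?Z. - (\<Sum>C\<in>chains_between L a z. (-1) ^ card C))"
    proof (intro sum.cong refl less.hyps)
      fix z assume z: "z \<in> ?Z"
      then have "{w\<in>L. a \<le> w \<and> w < z} \<subset> ?Z" by auto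
      then show "card {w\<in>L. a \<le> w \<and> w < z} < card ?Z" using fin by (simp add: psubset_card_mono)
    qed auto
    also have "\<dots> = (\<Sum>z\<in>?Z. \<Sum>C\<in>chains_between L a z. (-1) ^ card (insert b C))"
    proof (intro sum.cong refl)
      fix z assume "z \<in> ?Z"
      then have "b \<notin> C" "finite C" if "C \<in> chains_between L a z" for C
        using that by (auto simp: chains_between_iff)
      then show "- (\<Sum>C\<in>chains_between L a z. (-1) ^ card C)
          = (\<Sum>C\<in>chains_between L a z. (-1) ^ card (insert b C) :: int)"
        by (simp add: sum_negf[symmetric])
    qed
    also have "\<dots> = (\<Sum>C\<in>chains_between L a b. (-1) ^ card C)"
      by (rule sum_chains_between_remove_top[OF L less.prems(1) ab, symmetric])
    finally show ?thesis .
  qed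
qed

text \<open>This is the weight \<open>- \<mu>(C, 1)\<close> that the chain \<open>C\<close> carries in \<open>gbar\<close>, written without the
  extra maximum of the chain lattice.\<close>

definition chain_weight :: "'b::order set \<Rightarrow> 'b \<Rightarrow> 'b \<Rightarrow> 'b set \<Rightarrow> int" where
  "chain_weight L a b C = (\<Sum>D\<in>{D\<in>chains_between L a b. C \<subseteq> D}. (-1) ^ card (D - C))"

lemma bounded_chains_mono_down:
  "C \<in> bounded_chains L a b \<Longrightarrow> D \<in> bounded_chains L a b \<Longrightarrow> C \<subseteq> X \<Longrightarrow> X \<subseteq> D \<Longrightarrow> X \<in> bounded_chains L a b"
  by (auto simp: bounded_chains_def intro: chain_subset finite_subset)

text \<open>Below the extra maximum every interval \<open>[C, D]\<close> of the chain lattice is the Boolean lattice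
  of the subsets of \<open>D - C\<close>.\<close>

lemma moebius_chain_lattice_Value:
  assumes C: "C \<in> bounded_chains L a b"
    and "D \<in> bounded_chains L a b" "C \<subseteq> D"
  shows "moebius (chain_lattice L a b) (top.Value C) (top.Value D) = (-1) ^ card (D - C)"
  using assms(2,3)
proof (induction "card D" arbitrary: D rule: less_induct)
  case less
  show ?case
  proof (cases "C = D")
    case True
    then show ?thesis by (simp add: moebius.simps)
  next
    case False
    have finD: "finite D" using less.prems by (simp add: bounded_chains_def)
    let ?I = "{X. C \<subseteq> X \<and> X \<subset> D}"
    have I: "{z \<in> chain_lattice L a b. top.Value C \<le> z \<and> z < top.Value D} = top.Value ` ?I"
    proof (intro set_eqI iffI)
      fix z assume "z \<in> {z \<in> chain_lattice L a b. top.Value C \<le> z \<and> z < top.Value D}"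
      then show "z \<in> top.Value ` ?I" by (cases z) simp_all
    next
      fix z assume "z \<in> top.Value ` ?I"
      then obtain X where X: "z = top.Value X" "C \<subseteq> X" "X \<subset> D" by blast
      then have "X \<in> bounded_chains L a b"
        using bounded_chains_mono_down[OF C less.prems(1)] by simp
      with X show "z \<in> {z \<in> chain_lattice L a b. top.Value C \<le> z \<and> z < top.Value D}"
        by (simp add: chain_lattice_def)
    qed
    have fin: "finite ?I" by (rule finite_subset[of _ "Pow D"]) (use finD in auto)
    have "moebius (chain_lattice L a b) (top.Value C) (top.Value D)
        = - (\<Sum>X\<in>?I. moebius (chain_lattice L a b) (top.Value C) (top.Value X))"
      using False less.prems(2) fin
      by (subst moebius.simps) (simp add: I sum.reindex inj_on_def psubset_eq)
    also have "(\<Sum>X\<in>?I. moebius (chain_lattice L a b) (top.Value C) (top.Value X))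
        = (\<Sum>X\<in>?I. (-1) ^ card (X - C))"
      using finD bounded_chains_mono_down[OF C less.prems(1)]
      by (intro sum.cong refl less.hyps) (auto intro: psubset_card_mono)
    also have "\<dots> = (\<Sum>Y\<in>Pow (D - C) - {D - C}. (-1) ^ card Y)"
      by (rule sum.reindex_bij_witness[of _ "\<lambda>Y. C \<union> Y" "\<lambda>X. X - C"])
         (use less.prems(2) in \<open>auto simp: Diff_Un\<close>)
    also have "\<dots> = (\<Sum>Y\<in>Pow (D - C). (-1) ^ card Y) - (-1) ^ card (D - C)"
      using finD by (simp add: sum_diff1)
    also have "(\<Sum>Y\<in>Pow (D - C). (-1) ^ card Y) = (0 :: int)"
      using prod_diff_conv_sum[of "D - C" "\<lambda>_. 1 :: int" "\<lambda>_. 1"] finD False less.prems(2)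
      by (auto split: if_splits simp: card_eq_0_iff power_0_left)
    finally show ?thesis by simp
  qed
qed

lemma moebius_chain_lattice_Top:
  assumes L: "finite L" and C: "C \<in> chains_between L a b"
  shows "- moebius (chain_lattice (L \<inter> {a..b}) a b) (top.Value C) top.Top = chain_weight L a b C"
proof -
  let ?L = "L \<inter> {a..b}"
  let ?I = "{D\<in>chains_between L a b. C \<subseteq> D}"
  have I: "{z \<in> chain_lattice ?L a b. top.Value C \<le> z \<and> z < top.Top} = top.Value ` ?I"
  proof (rule set_eqI)
    fix z
    show "z \<in> {z \<in> chain_lattice ?L a b. top.Value C \<le> z \<and> z < top.Top} \<longleftrightarrow> z \<in> top.Value ` ?I"
      by (cases z) (simp_all add: chain_lattice_def image_iff)
  qed
  have fin: "finite ?I" using L by (simp add: finite_bounded_chains)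
  have "moebius (chain_lattice ?L a b) (top.Value C) top.Top
      = - (\<Sum>X\<in>?I. moebius (chain_lattice ?L a b) (top.Value C) (top.Value X))"
    using fin by (subst moebius.simps) (simp add: I sum.reindex inj_on_def)
  also have "(\<Sum>X\<in>?I. moebius (chain_lattice ?L a b) (top.Value C) (top.Value X))
      = chain_weight L a b C"
    unfolding chain_weight_def using L C
    by (intro sum.cong refl moebius_chain_lattice_Value) auto
  finally show ?thesis by simp
qed

text \<open>A refinement of \<open>insert b C\<close> splits at \<open>z\<close> into a refinement of \<open>C\<close> and a chain from
  \<open>z\<close> to \<open>b\<close>; by Hall's theorem the latter contribute the Moebius function.\<close>

lemma chain_weight_insert_top:
  assumes L: "finite L" and C: "C \<in> chains_between L a z" and zb: "b \<in> L" "z < b"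
  shows "chain_weight L a b (insert b C) = - moebius L z b * chain_weight L a z C"
proof -
  let ?X = "{D\<in>chains_between L a z. C \<subseteq> D}" and ?Y = "chains_between L z b"
  have zL: "z \<in> L" "z \<in> C" using C by (auto simp: chains_between_iff)
  have cross: "x \<le> y" if "D \<in> ?X" "E \<in> ?Y" "x \<in> D" "y \<in> E" for D E x y
    using that by (auto simp: chains_between_iff intro: order_trans)
  have "chain_weight L a b (insert b C)
      = (\<Sum>(D, E)\<in>?X \<times> ?Y. (-1) ^ card (D - C) * (-1) ^ card E)"
    unfolding chain_weight_def
  proof (rule sum.reindex_bij_witness[symmetric,
        of _ "\<lambda>D. (D \<inter> {..z}, D \<inter> {z..})" "\<lambda>(D, E). D \<union> E"], goal_cases)
    case (1 p)
    obtain D E where p: "p = (D, E)" and D: "D \<in> ?X" and E: "E \<in> ?Y" using 1 by auto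
    have "z \<in> D" "z \<in> E" "\<And>x. x \<in> D \<Longrightarrow> x \<le> z" "\<And>x. x \<in> E \<Longrightarrow> z \<le> x"
      using D E by (auto simp: chains_between_iff)
    then have "(D \<union> E) \<inter> {..z} = D" "(D \<union> E) \<inter> {z..} = E" by (auto dest: antisym)
    then show ?case by (simp add: p)
  next
    case (2 p)
    obtain D E where p: "p = (D, E)" and D: "D \<in> ?X" and E: "E \<in> ?Y" using 2 by auto
    have "chain_of (D \<union> E)"
    proof (rule chainI)
      fix x y assume "x \<in> D \<union> E" "y \<in> D \<union> E"
      moreover have "chain_of D" "chain_of E" using D E by (auto simp: chains_between_iff)
      ultimately show "x \<le> y \<or> y \<le> x" using cross[OF D E] by (auto dest: chainD)
    qed
    moreover have "x \<le> b" if "x \<in> D" for x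
      using that D zb by (auto simp: chains_between_iff intro: order_trans[OF _ less_imp_le])
    moreover have "a \<le> x" if "x \<in> E" for x
    proof -
      have "a \<in> D" using D by (auto simp: chains_between_iff)
      then show ?thesis using cross[OF D E] that by blast
    qed
    ultimately show ?case using D E by (auto simp: p chains_between_iff)
  next
    case (3 D)
    then have D: "D \<in> chains_between L a b" "insert b C \<subseteq> D" by auto
    have "x \<le> z \<or> z \<le> x" if "x \<in> D" for x
      using D that zL by (auto simp: chains_between_iff dest: chainD)
    then show ?case by auto
  next
    case (4 D)
    then have D: "D \<in> chains_between L a b" "insert b C \<subseteq> D" by auto
    then show ?case using C zb
      by (auto simp: chains_between_iff intro: chain_subset)
  next
    case (5 p)
    obtain D E where p: "p = (D, E)" and D: "D \<in> ?X" and E: "E \<in> ?Y" using 5 by auto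
    have fin: "finite D" "finite E" using D E by (auto simp: chains_between_iff)
    have zbE: "z \<in> E" "b \<in> E" using E by (auto simp: chains_between_iff)
    have leD: "x \<le> z" if "x \<in> D" for x using D that by (auto simp: chains_between_iff)
    have geE: "z \<le> x" if "x \<in> E" for x using E that by (auto simp: chains_between_iff)
    have CD: "C \<subseteq> D" using D by auto
    have "D \<union> E - insert b C = (D - C) \<union> (E - {z, b})"
    proof -
      have "b \<notin> D" using leD[of b] zb by auto
      moreover have "x \<notin> C" if "x \<in> E" "x \<noteq> z" for x
        using that leD geE CD by (meson antisym subsetD)
      ultimately show ?thesis using zL by auto
    qed
    moreover have "(D - C) \<inter> (E - {z, b}) = {}" using leD geE by (auto dest: antisym)
    ultimately have "card (D \<union> E - insert b C) = card (D - C) + card (E - {z, b})"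
      using fin by (simp add: card_Un_disjoint)
    \<comment> \<open>The members \<open>z\<close> and \<open>b\<close> of \<open>E\<close> are already in \<open>insert b C\<close>; being two, they do not
      affect the sign.\<close>
    moreover have "card E = card (E - {z, b}) + 2"
      using fin zbE zb card_Diff_subset[of "{z, b}" E] card_mono[of E "{z, b}"] by simp
    ultimately show ?case by (simp add: p power_add)
  qed
  also have "\<dots> = (\<Sum>D\<in>?X. (-1) ^ card (D - C)) * (\<Sum>E\<in>?Y. (-1) ^ card E)"
    by (simp add: sum_product sum.cartesian_product)
  also have "(\<Sum>E\<in>?Y. (-1) ^ card E) = - moebius L z b"
    using moebius_eq_chain_sum[OF L zb(1)] zb(2) by simp
  finally show ?thesis by (simp add: chain_weight_def)
qed

section \<open>The path of a chain\<close>

text \<open>Uniqueness of the increasing enumeration is what makes the description in \<open>chain_path\<close>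
  denote a list.\<close>

lemma sorted_wrt_less_unique:
  fixes xs ys :: "'b::order list"
  assumes "sorted_wrt (<) xs" "sorted_wrt (<) ys" "set xs = set ys"
  shows "xs = ys"
  using assms
proof (induction xs arbitrary: ys)
  case Nil
  then show ?case by simp
next
  case (Cons x xs)
  then obtain y ys' where ys: "ys = y # ys'" by (cases ys) auto
  have x: "\<forall>z\<in>set xs. x < z" and y: "\<forall>z\<in>set ys'. y < z" using Cons.prems ys by auto
  have "x = y"
  proof (rule ccontr)
    assume "x \<noteq> y"
    then have "x \<in> set ys'" "y \<in> set xs" using Cons.prems(3) ys by auto
    then show False using x y by (meson less_asym)
  qed
  moreover have "x \<notin> set xs" "y \<notin> set ys'" using x y by auto
  ultimately have "set xs = set ys'" using Cons.prems(3) ys by (simp add: insert_ident)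
  then show ?case using Cons \<open>x = y\<close> ys by auto
qed

lemma finite_chain_sorted_list:
  fixes C :: "'b::order set"
  assumes "finite C" "chain_of C"
  shows "\<exists>xs. sorted_wrt (<) xs \<and> set xs = C"
  using assms
proof (induction "card C" arbitrary: C rule: less_induct)
  case less
  show ?case
  proof (cases "C = {}")
    case False
    obtain z where z: "z \<in> C" "\<And>x. x \<in> C \<Longrightarrow> x \<le> z"
      using finite_chain_greatest[OF less.prems(1) False less.prems(2)] by blast
    have "card (C - {z}) < card C" using z(1) less.prems(1) by (rule card_Diff1_less[rotated])
    moreover have "chain_of (C - {z})" using less.prems(2) by (rule chain_subset) auto
    ultimately obtain xs where xs: "sorted_wrt (<) xs" "set xs = C - {z}"
      using less.hyps[of "C - {z}"] less.prems(1) by auto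
    have "\<forall>x\<in>set xs. x < z" using xs(2) z(2) by (auto simp: less_le)
    then have "sorted_wrt (<) (xs @ [z])" "set (xs @ [z]) = C"
      using xs z(1) by (auto simp: sorted_wrt_append)
    then show ?thesis by blast
  qed (auto intro: exI[of _ "[]"])
qed

lemma chain_path_eq:
  assumes "sorted_wrt (\<subset>) Cs" "set Cs = C"
  shows "chain_path M C = path_of_list M Cs"
  unfolding chain_path_def using assms sorted_wrt_less_unique
  by (intro arg_cong[of _ _ "path_of_list M"] the_equality) blast+

lemma path_of_list_snoc:
  "Cs \<noteq> [] \<Longrightarrow> path_of_list M (Cs @ [B]) = path_of_list M Cs @
     replicate (rk M B - rk M (last Cs)) North @ replicate (nullity M B - nullity M (last Cs)) East"
  by (induction M Cs rule: path_of_list.induct) auto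

lemma path_of_list_restriction:
  "(\<And>X. X \<in> set Cs \<Longrightarrow> X \<subseteq> A) \<Longrightarrow> path_of_list (restriction M A) Cs = path_of_list M Cs"
  by (induction M Cs rule: path_of_list.induct) (auto simp: rk_restriction nullity_restriction)

lemma chain_path_restriction:
  assumes "C \<in> chains_between L {} A"
  shows "chain_path (restriction M A) C = chain_path M C"
proof -
  obtain Cs where Cs: "sorted_wrt (\<subset>) Cs" "set Cs = C"
    using finite_chain_sorted_list[of C] assms by (auto simp: chains_between_iff)
  have "X \<subseteq> A" if "X \<in> set Cs" for X using assms that Cs by (auto simp: chains_between_iff)
  then show ?thesis by (simp add: chain_path_eq[OF Cs] path_of_list_restriction)
qed

lemma chain_path_insert_top:
  assumes C: "C \<in> chains_between L {} A" and AB: "A \<subset> B"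
  shows "chain_path M (insert B C) = chain_path M C @
    replicate (rk M B - rk M A) North @ replicate (nullity M B - nullity M A) East"
proof -
  obtain Cs where Cs: "sorted_wrt (\<subset>) Cs" "set Cs = C"
    using finite_chain_sorted_list[of C] C by (auto simp: chains_between_iff)
  have A: "A \<in> set Cs" "\<And>X. X \<in> set Cs \<Longrightarrow> X \<subseteq> A" using C Cs by (auto simp: chains_between_iff)
  then have ne: "Cs \<noteq> []" by auto
  have "last Cs = A"
  proof (rule ccontr)
    assume "last Cs \<noteq> A"
    moreover have Cs': "Cs = butlast Cs @ [last Cs]" using ne by simp
    ultimately have "A \<in> set (butlast Cs)" using A(1) by (metis Un_iff empty_iff insert_iff list.set set_append)
    then have "A \<subset> last Cs" using Cs(1) Cs' by (metis sorted_wrt_append list.set_intros(1))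
    then show False using A(2)[of "last Cs"] ne by auto
  qed
  have "X \<subset> B" if "X \<in> set Cs" for X using A(2)[OF that] AB by blast
  then have "sorted_wrt (\<subset>) (Cs @ [B])" "set (Cs @ [B]) = insert B C"
    using Cs by (auto simp: sorted_wrt_append)
  from chain_path_eq[OF this] show ?thesis
    by (simp add: chain_path_eq[OF Cs] path_of_list_snoc[OF ne] \<open>last Cs = A\<close>)
qed

lemma count_list_replicate: "count_list (replicate n x) y = (if x = y then n else 0)"
  by (induction n) auto

text \<open>The path of a chain ends in the point given by nullity and rank of its top member; its last
  step, if any, is an east step because the nullity increases strictly.\<close>

lemma chain_path_ends:
  assumes "C \<in> chains_between (cyclic_flats M) {} A"
  shows "count_list (chain_path M C) North = rk M A \<and> count_list (chain_path M C) East = nullity M A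
    \<and> (chain_path M C = [] \<or> last (chain_path M C) = East)"
  using assms
proof (induction "card A" arbitrary: A C rule: less_induct)
  case less
  have A: "A \<in> cyclic_flats M" using less.prems by (auto simp: chains_between_iff)
  show ?case
  proof (cases "A = {}")
    case True
    have "{} \<in> C" "\<forall>x\<in>C. x \<subseteq> A" using less.prems unfolding chains_between_iff by auto
    then have "sorted_wrt (\<subset>) [{}]" "set [{}] = C" using True by auto
    from chain_path_eq[OF this] show ?thesis using True by (simp add: nullity_def)
  next
    case False
    then have "{} < A" by auto
    with less.prems obtain z C' where z: "z \<in> cyclic_flats M" "z < A"
      and C': "C' \<in> chains_between (cyclic_flats M) {} z" "C = insert A C'"
      by (rule chains_between_cases) auto
    have rk: "rk M z < rk M A" and nul: "nullity M z < nullity M A"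
      using rk_strict_mono_cyclic_flats nullity_strict_mono_cyclic_flats z A by blast+
    have "card z < card A" using z(2) cyclic_flatsD(2)[OF A] by (simp add: psubset_card_mono)
    note IH = less.hyps[OF this C'(1)]
    show ?thesis unfolding C'(2) chain_path_insert_top[OF C'(1) z(2)] using IH rk nul
      by (simp add: count_list_append count_list_replicate)
  qed
qed

section \<open>Points below a path\<close>

lemma path_points_subset: "(x, y) \<in> path_points P \<Longrightarrow> x \<le> count_list P East \<and> y \<le> count_list P North"
proof -
  have "count_list (take j P) s \<le> count_list P s" for j s
    by (metis append_take_drop_id count_list_append le_add1)
  then show "(x, y) \<in> path_points P \<Longrightarrow> x \<le> count_list P East \<and> y \<le> count_list P North"
    by (auto simp: path_points_def)
qed

lemma path_points_end: "(count_list P East, count_list P North) \<in> path_points P"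
  by (auto simp: path_points_def intro: exI[of _ "length P"])

lemma path_points_append:
  "path_points (P @ Q) = path_points P \<union>
     (\<lambda>(x, y). (count_list P East + x, count_list P North + y)) ` path_points Q"
proof (intro equalityI subsetI)
  fix p assume "p \<in> path_points (P @ Q)"
  then obtain j where j: "j \<le> length P + length Q"
    "p = (count_list (take j (P @ Q)) East, count_list (take j (P @ Q)) North)"
    by (auto simp: path_points_def)
  show "p \<in> path_points P \<union>
     (\<lambda>(x, y). (count_list P East + x, count_list P North + y)) ` path_points Q"
  proof (cases "j \<le> length P")
    case True
    then show ?thesis using j by (auto simp: path_points_def)
  next
    case False
    then have "(count_list (take (j - length P) Q) East, count_list (take (j - length P) Q) North)
        \<in> path_points Q" using j by (auto simp: path_points_def)
    then show ?thesis using False j by (force simp: count_list_append)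
  qed
next
  fix p assume "p \<in> path_points P \<union>
     (\<lambda>(x, y). (count_list P East + x, count_list P North + y)) ` path_points Q"
  then show "p \<in> path_points (P @ Q)"
  proof
    assume "p \<in> path_points P"
    then obtain j where "j \<le> length P" "p = (count_list (take j P) East, count_list (take j P) North)"
      by (auto simp: path_points_def)
    then show ?thesis by (auto simp: path_points_def intro!: exI[of _ j])
  next
    assume "p \<in> (\<lambda>(x, y). (count_list P East + x, count_list P North + y)) ` path_points Q"
    then obtain j where "j \<le> length Q" "p = (count_list P East + count_list (take j Q) East,
        count_list P North + count_list (take j Q) North)"
      by (auto simp: path_points_def)
    then show ?thesis
      by (auto simp: path_points_def count_list_append intro!: exI[of _ "length P + j"])
  qed
qed

lemma path_points_replicate:
  "path_points (replicate a North) = {(0, j) |j. j \<le> a}"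
  "path_points (replicate b East) = {(j, 0) |j. j \<le> b}"
  unfolding path_points_def length_replicate take_replicate count_list_replicate
  by auto (metis min.absorb1)+

lemma path_points_append_corner:
  "path_points (P @ replicate a North @ replicate b East) = path_points P \<union>
     {(count_list P East, count_list P North + j) |j. j \<le> a} \<union>
     {(count_list P East + j, count_list P North + a) |j. j \<le> b}"
  unfolding path_points_append path_points_replicate
  by (simp add: image_Un image_image setcompr_eq_image count_list_replicate Un_assoc)

text \<open>Every column meets the path. Without this, the minimum that defines \<open>points_below\<close> could be
  the unspecified minimum of an empty set.\<close>

lemma path_points_column_nonempty:
  "x \<le> count_list P East \<Longrightarrow> \<exists>y. (x, y) \<in> path_points P"
proof (induction P rule: rev_induct)
  case Nil
  then show ?case using path_points_end[of "[]"] by auto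
next
  case (snoc s P)
  show ?case
  proof (cases "x \<le> count_list P East")
    case True
    then show ?thesis using snoc.IH by (auto simp: path_points_append)
  next
    case False
    then have "x = count_list (P @ [s]) East" using snoc.prems by (auto split: if_splits)
    then show ?thesis using path_points_end[of "P @ [s]"] by auto
  qed
qed

lemma mem_points_below_iff:
  "(x, y) \<in> points_below P \<longleftrightarrow> 1 \<le> x \<and> x < count_list P East \<and> 1 \<le> y \<and> y < count_list P North \<and>
     (\<forall>y'. (x, y') \<in> path_points P \<longrightarrow> y < y')"
proof (cases "x < count_list P East")
  case True
  let ?Y = "{y'. (x, y') \<in> path_points P}"
  have "finite ?Y"
    by (rule finite_subset[of _ "{..count_list P North}"]) (auto dest: path_points_subset)
  moreover have "?Y \<noteq> {}" using path_points_column_nonempty[of x P] True by auto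
  ultimately show ?thesis by (auto simp: points_below_def)
qed (auto simp: points_below_def)

lemma finite_points_below: "finite (points_below P)"
  by (rule finite_subset[of _ "{..count_list P East} \<times> {..count_list P North}"])
     (auto simp: points_below_def)

text \<open>If the path \<open>P\<close> ends at \<open>(l, r)\<close> with an east step or is empty, then it meets the line \<open>x = l\<close> only at
  height \<open>r\<close>. After appending \<open>a\<close> north and \<open>b\<close> east steps, the new points below the path are
  therefore the part of that line below height \<open>r\<close> and the full columns to its right. This one
  exceptional column is responsible for the case distinction in the recursion.\<close>

lemma points_below_append_corner:
  fixes P a b
  defines "l \<equiv> count_list P East" and "r \<equiv> count_list P North"
  assumes P: "P = [] \<or> last P = East" and b: "0 < b"
  shows "points_below (P @ replicate a North @ replicate b East) =
    points_below P \<union> {l} \<times> {1..<r} \<union> {l<..<l + b} \<times> {1..<r + a}"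
proof -
  have last_col: "y = r" if "(l, y) \<in> path_points P" for y
  proof (cases "P = []")
    case False
    then have "P = butlast P @ [East]" using P by (metis append_butlast_last_id)
    then obtain P' where P': "P = P' @ [East]" by blast
    have "path_points [East] = {(0, 0), (1, 0)}"
      using path_points_replicate(2)[of 1] by (auto simp: le_Suc_eq)
    then show ?thesis using that path_points_subset[of l y P']
      by (auto simp: P' path_points_append l_def r_def)
  qed (use that in \<open>auto simp: path_points_def l_def r_def\<close>)
  have l0: "r = 0" if "l = 0"
  proof (rule ccontr)
    assume "r \<noteq> 0"
    then have "P \<noteq> []" by (auto simp: r_def)
    then have "East \<in> set P" using P by (metis last_in_set)
    then show False using that by (simp add: l_def count_list_0_iff)
  qed
  have end_pt: "(l, r) \<in> path_points P" using path_points_end by (simp add: l_def r_def)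
  have le: "x \<le> l" "y \<le> r" if "(x, y) \<in> path_points P" for x y
    using path_points_subset[OF that] by (auto simp: l_def r_def)
  show ?thesis
  proof (rule set_eqI, clarify)
    fix x y
    let ?P = "P @ replicate a North @ replicate b East"
    have pts: "(x, y') \<in> path_points ?P \<longleftrightarrow> (x, y') \<in> path_points P \<or>
        (x = l \<and> (\<exists>j\<le>a. y' = r + j)) \<or> (\<exists>j\<le>b. x = l + j \<and> y' = r + a)" for y'
      unfolding path_points_append_corner by (auto simp: l_def r_def)
    have cnt: "count_list ?P East = l + b" "count_list ?P North = r + a"
      by (auto simp: count_list_append count_list_replicate l_def r_def)
    consider "x < l" | "x = l" | "l < x" by linarith
    then show "(x, y) \<in> points_below ?P \<longleftrightarrow>
        (x, y) \<in> points_below P \<union> {l} \<times> {1..<r} \<union> {l<..<l + b} \<times> {1..<r + a}"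
    proof cases
      case 1
      obtain y0 where "(x, y0) \<in> path_points P"
        using path_points_column_nonempty[of x P] 1 by (auto simp: l_def)
      then have "y < r" if "\<forall>y'. (x, y') \<in> path_points P \<longrightarrow> y < y'" using that le(2) by fastforce
      then show ?thesis using 1 by (auto simp: mem_points_below_iff pts cnt count_list_replicate simp flip: l_def r_def)
    next
      case 2
      have "(\<forall>y'. (l, y') \<in> path_points ?P \<longrightarrow> y < y') \<longleftrightarrow> y < r"
      proof
        assume "\<forall>y'. (l, y') \<in> path_points ?P \<longrightarrow> y < y'"
        then show "y < r" using pts[of r] end_pt 2 by simp
      next
        assume y: "y < r"
        have "r \<le> y'" if "(l, y') \<in> path_points ?P" for y'
          using that pts[of y'] last_col[of y'] 2 by auto
        then show "\<forall>y'. (l, y') \<in> path_points ?P \<longrightarrow> y < y'" using y by (meson less_le_trans)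
      qed
      moreover have "r = 0 \<or> 1 \<le> l" using l0 by auto
      ultimately show ?thesis using 2 b
        by (auto simp: mem_points_below_iff cnt count_list_replicate simp flip: l_def r_def)
    next
      case 3
      have "(\<forall>y'. (x, y') \<in> path_points ?P \<longrightarrow> y < y') \<longleftrightarrow> y < r + a" if "x < l + b"
      proof -
        have "(x, y') \<in> path_points ?P \<longleftrightarrow> y' = r + a" for y'
          using pts[of y'] le(1)[of x y'] 3 that by (auto intro: exI[of _ "x - l"])
        then show ?thesis by simp
      qed
      then show ?thesis using 3
        by (auto simp: mem_points_below_iff cnt count_list_replicate simp flip: l_def r_def)
    qed
  qed
qed

section \<open>Counting chains of points\<close>

text \<open>Strict chains for the product order that is strict in both coordinates; they are the sets
  counted by \<open>num_chains_below\<close>, freed from their enumeration.\<close>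

definition strict_chain :: "(nat \<times> nat) set \<Rightarrow> bool" where
  "strict_chain S \<longleftrightarrow> (\<forall>p\<in>S. \<forall>q\<in>S. p = q \<or> (fst p < fst q \<and> snd p < snd q) \<or>
     (fst q < fst p \<and> snd q < snd p))"

definition point_chains :: "(nat \<times> nat) set \<Rightarrow> nat \<Rightarrow> (nat \<times> nat) set set" where
  "point_chains X k = {S. S \<subseteq> X \<and> strict_chain S \<and> (\<forall>p\<in>S. snd p < k)}"

definition chain_poly :: "(nat \<times> nat) set \<Rightarrow> nat \<Rightarrow> int poly" where
  "chain_poly X k = (\<Sum>S\<in>point_chains X k. monom 1 (card S))"

lemma finite_point_chains: "finite X \<Longrightarrow> finite (point_chains X k)"
  by (rule finite_subset[of _ "Pow X"]) (auto simp: point_chains_def)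

lemma strict_chain_subset: "strict_chain S \<Longrightarrow> T \<subseteq> S \<Longrightarrow> strict_chain T"
  unfolding strict_chain_def by blast

lemma strict_chain_inj:
  assumes "strict_chain S"
  shows "inj_on fst S" "inj_on snd S"
proof -
  have "p = q \<or> (fst p < fst q \<and> snd p < snd q) \<or> (fst q < fst p \<and> snd q < snd p)"
    if "p \<in> S" "q \<in> S" for p q
    using assms that by (simp add: strict_chain_def)
  then show "inj_on fst S" "inj_on snd S" unfolding inj_on_def by (metis less_irrefl)+
qed

lemma strict_chain_card:
  assumes "strict_chain S"
  shows "card (fst ` S) = card S" "card (snd ` S) = card S"
  using strict_chain_inj[OF assms] by (simp_all add: card_image)

text \<open>A strict chain is determined by its two projections: its top point is the pair of their
  maxima.\<close>

lemma strict_chain_projections_unique: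
  assumes "finite S" "strict_chain S" "strict_chain T" "fst ` S = fst ` T" "snd ` S = snd ` T"
  shows "S = T"
  using assms
proof (induction "card S" arbitrary: S T rule: less_induct)
  case less
  have max: "(Max (fst ` C), Max (snd ` C)) \<in> C" if C: "strict_chain C" "finite C" "C \<noteq> {}" for C
  proof -
    have "Max (fst ` C) \<in> fst ` C" using C by (intro Max_in) auto
    then obtain p where p: "p \<in> C" "fst p = Max (fst ` C)" by auto
    have "snd q \<le> snd p" if "q \<in> C" for q
    proof -
      have "fst q \<le> fst p" using p(2) C(2) that by simp
      then show ?thesis using C(1) p(1) that by (fastforce simp: strict_chain_def)
    qed
    then have "snd p = Max (snd ` C)" using p(1) C(2) by (intro Max_eqI[symmetric]) auto
    then show ?thesis using p by (metis prod.collapse)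
  qed
  show ?case
  proof (cases "S = {}")
    case True
    then show ?thesis using less.prems by auto
  next
    case False
    have "finite (fst ` T)" using less.prems(1,4) by (metis finite_imageI)
    then have fT: "finite T" using strict_chain_inj(1)[OF less.prems(3)] by (rule finite_imageD)
    have T: "T \<noteq> {}" using False less.prems(4) by auto
    define m where "m = (Max (fst ` S), Max (snd ` S))"
    have mS: "m \<in> S" using max[OF less.prems(2,1) False] by (simp add: m_def)
    have mT: "m \<in> T" using max[OF less.prems(3) fT T] less.prems(4,5) by (simp add: m_def)
    have im: "fst ` (C - {m}) = fst ` C - {fst m}" "snd ` (C - {m}) = snd ` C - {snd m}"
      if "strict_chain C" "m \<in> C" for C
      using that strict_chain_inj[OF that(1)] by (auto simp: inj_on_def)
    have "S - {m} = T - {m}"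
    proof (rule less.hyps)
      show "card (S - {m}) < card S" using mS less.prems(1) by (rule card_Diff1_less[rotated])
      show "strict_chain (S - {m})" "strict_chain (T - {m})"
        using less.prems(2,3) by (auto elim: strict_chain_subset)
    qed (use less.prems mS mT im in auto)
    then show ?thesis using mS mT by blast
  qed
qed

lemma strict_chain_of_enumerations:
  fixes x y :: "nat \<Rightarrow> nat"
  assumes "strict_mono_on I x" "strict_mono_on I y"
  shows "strict_chain ((\<lambda>j. (x j, y j)) ` I)"
  unfolding strict_chain_def using assms
  by (auto simp: strict_mono_on_def) (metis nat_neq_iff)+

lemma ex_enumeration:
  fixes U :: "nat set"
  assumes "finite U"
  shows "\<exists>x. x ` {1..card U} = U \<and> strict_mono_on {1..card U} x"
proof -
  obtain h where h: "bij_betw h {..<card U} U" "strict_mono_on {..<card U} h"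
    using ex_bij_betw_strict_mono_card[OF assms] by blast
  have "(\<lambda>j. j - 1) ` {1..card U} = {..<card U}"
    by (auto simp: image_iff intro!: bexI[of _ "Suc _"])
  then have "(\<lambda>j. h (j - 1)) ` {1..card U} = U"
    using bij_betw_imp_surj_on[OF h(1)] by (metis image_image)
  moreover have "strict_mono_on {1..card U} (\<lambda>j. h (j - 1))"
  proof (rule strict_mono_onI)
    fix r s assume "r \<in> {1..card U}" "s \<in> {1..card U}" "r < s"
    then show "h (r - 1) < h (s - 1)" using strict_mono_onD[OF h(2), of "r - 1" "s - 1"] by auto
  qed
  ultimately show ?thesis by (intro exI conjI)
qed

lemma ex_strict_chain_enumerated:
  fixes U V :: "nat set"
  assumes "finite U" "finite V" "card U = card V"
  shows "\<exists>x y. strict_mono_on {1..card U} x \<and> strict_mono_on {1..card U} y \<and>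
    fst ` (\<lambda>j. (x j, y j)) ` {1..card U} = U \<and> snd ` (\<lambda>j. (x j, y j)) ` {1..card U} = V"
proof -
  obtain x where "x ` {1..card U} = U" "strict_mono_on {1..card U} x"
    using ex_enumeration[OF assms(1)] by blast
  moreover obtain y where "y ` {1..card U} = V" "strict_mono_on {1..card U} y"
    using ex_enumeration[OF assms(2)] assms(3) by auto
  ultimately show ?thesis by (intro exI[of _ x] exI[of _ y]) (simp add: image_image)
qed

lemma num_chains_below_eq:
  "num_chains_below i k P = card {S \<in> point_chains (points_below P) k. card S = i}"
proof -
  have "(\<exists>x y. S = (\<lambda>j. (x j, y j)) ` {1..i} \<and> strict_mono_on {1..i} x \<and>
      strict_mono_on {1..i} y \<and> (\<forall>j\<in>{1..i}. y j < k))
    \<longleftrightarrow> strict_chain S \<and> (\<forall>p\<in>S. snd p < k) \<and> card S = i" (is "?L \<longleftrightarrow> ?R")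
    if S: "S \<subseteq> points_below P" for S
  proof
    assume ?L
    then obtain x y where xy: "S = (\<lambda>j. (x j, y j)) ` {1..i}" "strict_mono_on {1..i} x"
      "strict_mono_on {1..i} y" "\<forall>j\<in>{1..i}. y j < k" by blast
    have "inj_on x {1..i}" using xy(2) by (rule strict_mono_on_imp_inj_on)
    then have "inj_on (\<lambda>j. (x j, y j)) {1..i}"
      using inj_on_imageI2[of fst "\<lambda>j. (x j, y j)"] by (simp add: comp_def)
    then have "card S = i" unfolding xy(1) by (simp add: card_image)
    then show ?R using xy(4) strict_chain_of_enumerations[OF xy(2,3)] by (auto simp: xy(1))
  next
    assume R: ?R
    have fin: "finite S" using S finite_points_below by (rule finite_subset)
    have "card (fst ` S) = i" "card (fst ` S) = card (snd ` S)"
      using R by (simp_all add: strict_chain_card)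
    then obtain x y where xy: "strict_mono_on {1..i} x" "strict_mono_on {1..i} y"
      "fst ` (\<lambda>j. (x j, y j)) ` {1..i} = fst ` S" "snd ` (\<lambda>j. (x j, y j)) ` {1..i} = snd ` S"
      using ex_strict_chain_enumerated[of "fst ` S" "snd ` S"] fin by auto
    have "S = (\<lambda>j. (x j, y j)) ` {1..i}"
      using fin R strict_chain_of_enumerations[OF xy(1,2)] xy(3,4)
      by (intro strict_chain_projections_unique) auto
    then show ?L using R xy(1,2) by (intro exI[of _ x] exI[of _ y]) auto
  qed
  then show ?thesis unfolding num_chains_below_def point_chains_def
    by (intro arg_cong[of _ _ card]) blast
qed

text \<open>The heights of a strict chain below \<open>P\<close> are distinct and lie strictly between \<open>0\<close> and the final
  height of \<open>P\<close>, so truncating the sum at that height loses no chain.\<close>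

lemma sum_num_chains_below:
  assumes "0 < count_list P North"
  shows "(\<Sum>i<count_list P North. monom (int (num_chains_below i k P)) i)
    = chain_poly (points_below P) k"
proof -
  let ?F = "point_chains (points_below P) k"
  have fin: "finite ?F" by (intro finite_point_chains finite_points_below)
  have less: "card S < count_list P North" if "S \<in> ?F" for S
  proof -
    have "snd ` S \<subseteq> {1..<count_list P North}"
      using that by (auto simp: point_chains_def mem_points_below_iff)
    then have "card (snd ` S) \<le> card {1..<count_list P North}" by (intro card_mono) auto
    then show ?thesis using that assms by (simp add: point_chains_def strict_chain_card)
  qed
  have "monom (int (num_chains_below i k P)) i
      = (\<Sum>S\<in>{S\<in>?F. card S = i}. monom 1 (card S))" for i
    by (simp add: num_chains_below_eq of_nat_poly smult_monom)
  then show ?thesis unfolding chain_poly_def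
    using sum.group[OF fin finite_lessThan, of card "count_list P North" "\<lambda>S. monom 1 (card S) :: int poly"] less
    by auto
qed

text \<open>Chains in the grid \<open>A \<times> B\<close> are pairs of equinumerous subsets of \<open>A\<close> and \<open>B\<close>.\<close>

lemma grid_chain_sum:
  fixes A B :: "nat set"
  assumes A: "finite A" and B: "finite B" and W: "\<And>V. V \<in> W \<Longrightarrow> V \<subseteq> B"
  shows "(\<Sum>S\<in>{S. S \<subseteq> A \<times> B \<and> strict_chain S \<and> snd ` S \<in> W}. monom 1 (card S))
    = (\<Sum>j\<le>card A. monom (int ((card A choose j) * card {V\<in>W. card V = j})) j :: int poly)"
proof -
  have finW: "finite W" by (rule finite_subset[of _ "Pow B"]) (use W B in auto)
  have finV: "finite V" if "V \<in> W" for V using W[OF that] B by (rule finite_subset)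
  let ?S = "{S. S \<subseteq> A \<times> B \<and> strict_chain S \<and> snd ` S \<in> W}"
  let ?T = "SIGMA U:Pow A. {V\<in>W. card V = card U}"
  have "bij_betw (\<lambda>S. (fst ` S, snd ` S)) ?S ?T"
  proof (rule bij_betw_imageI)
    show "inj_on (\<lambda>S. (fst ` S, snd ` S)) ?S"
    proof (rule inj_onI)
      fix S T assume S: "S \<in> ?S" and T: "T \<in> ?S" and eq: "(fst ` S, snd ` S) = (fst ` T, snd ` T)"
      have "finite S" using S A B by (auto intro: finite_subset)
      then show "S = T" using S T eq by (intro strict_chain_projections_unique) auto
    qed
    show "(\<lambda>S. (fst ` S, snd ` S)) ` ?S = ?T"
    proof (intro equalityI subsetI)
      fix p assume "p \<in> (\<lambda>S. (fst ` S, snd ` S)) ` ?S"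
      then obtain S where S: "S \<subseteq> A \<times> B" "strict_chain S" "snd ` S \<in> W" "p = (fst ` S, snd ` S)"
        by blast
      then show "p \<in> ?T" using strict_chain_card[OF S(2)] by auto
    next
      fix p assume "p \<in> ?T"
      then obtain U V where p: "p = (U, V)" "U \<subseteq> A" "V \<in> W" "card U = card V" by auto
      obtain x y where xy: "strict_mono_on {1..card U} x" "strict_mono_on {1..card U} y"
        "fst ` (\<lambda>j. (x j, y j)) ` {1..card U} = U" "snd ` (\<lambda>j. (x j, y j)) ` {1..card U} = V"
        using ex_strict_chain_enumerated[OF finite_subset[OF p(2) A] finV[OF p(3)] p(4)] by blast
      let ?C = "(\<lambda>j. (x j, y j)) ` {1..card U}"
      have "?C \<subseteq> fst ` ?C \<times> snd ` ?C" by force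
      then have "?C \<subseteq> A \<times> B" unfolding xy(3,4) using p(2) W[OF p(3)] by blast
      moreover have "strict_chain ?C" using xy(1,2) by (rule strict_chain_of_enumerations)
      ultimately have "?C \<in> ?S" using xy(4) p(3) by simp
      then show "p \<in> (\<lambda>S. (fst ` S, snd ` S)) ` ?S"
        by (rule image_eqI[rotated]) (use xy(3,4) p(1) in simp)
    qed
  qed
  then have "(\<Sum>S\<in>?S. monom 1 (card (fst ` S))) = (\<Sum>(U, V)\<in>?T. monom (1::int) (card U))"
    by (simp add: sum.reindex_bij_betw[symmetric] case_prod_unfold)
  also have "(\<Sum>S\<in>?S. monom 1 (card (fst ` S))) = (\<Sum>S\<in>?S. monom (1::int) (card S))"
    by (intro sum.cong) (auto simp: strict_chain_card)
  also have "(\<Sum>(U, V)\<in>?T. monom (1::int) (card U))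
      = (\<Sum>U\<in>Pow A. \<Sum>V\<in>{V\<in>W. card V = card U}. monom 1 (card U))"
    using A finW by (intro sum.Sigma[symmetric]) auto
  also have "\<dots> = (\<Sum>U\<in>Pow A. monom (int (card {V\<in>W. card V = card U})) (card U))"
    by (simp add: of_nat_poly smult_monom)
  also have "\<dots> = (\<Sum>j\<le>card A. \<Sum>U\<in>{U\<in>Pow A. card U = j}.
      monom (int (card {V\<in>W. card V = card U})) (card U))"
    using A by (intro sum.group[symmetric]) (auto intro: card_mono)
  also have "\<dots> = (\<Sum>j\<le>card A. monom (int ((card A choose j) * card {V\<in>W. card V = j})) j)"
  proof (intro sum.cong refl)
    fix j
    have "card {U\<in>Pow A. card U = j} = card A choose j"
      using n_subsets[OF A, of j] by (simp add: Pow_def)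
    then show "(\<Sum>U\<in>{U\<in>Pow A. card U = j}. monom (int (card {V\<in>W. card V = card U})) (card U))
        = monom (int ((card A choose j) * card {V\<in>W. card V = j})) j"
      by (simp add: of_nat_poly smult_monom)
  qed
  finally show ?thesis .
qed

lemma Q1_nat: "Q1 (int r) (int l) = (\<Sum>j\<le>l. monom (int ((l choose j) * (r choose j))) j)"
  unfolding Q1_def by (rule sum.mono_neutral_cong_left) (auto simp: mult.commute)

lemma Q2_nat:
  "Q2 (int r) (int l) = (\<Sum>j\<le>l. monom (int ((l choose j) * (if j = 0 then 0 else r choose (j - 1)))) j)"
  unfolding Q2_def by (rule sum.mono_neutral_cong_left) (auto simp: mult.commute)

text \<open>In a full grid the two projections can be chosen independently, which gives the products of
  binomial coefficients in \<open>Q1\<close>.\<close>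

lemma sum_grid_chains:
  fixes A B :: "nat set"
  assumes "finite A" "finite B"
  shows "(\<Sum>S\<in>{S. S \<subseteq> A \<times> B \<and> strict_chain S}. monom 1 (card S)) = Q1 (int (card B)) (int (card A))"
proof -
  have "{S. S \<subseteq> A \<times> B \<and> strict_chain S} = {S. S \<subseteq> A \<times> B \<and> strict_chain S \<and> snd ` S \<in> Pow B}"
    by auto
  moreover have "card {V\<in>Pow B. card V = j} = card B choose j" for j
    using n_subsets[OF assms(2), of j] by (simp add: Pow_def)
  ultimately show ?thesis
    using grid_chain_sum[OF assms, of "Pow B"] by (simp add: Q1_nat)
qed

text \<open>When the lowest height \<open>m\<close> is prescribed, only \<open>j - 1\<close> of the \<open>j\<close> heights remain to be
  chosen. This is the shift that distinguishes \<open>Q2\<close> from \<open>Q1\<close>.\<close>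

lemma sum_grid_chains_min:
  fixes A :: "nat set"
  assumes "finite A" "m < k"
  shows "(\<Sum>S\<in>{S. S \<subseteq> A \<times> {m..<k} \<and> strict_chain S \<and> m \<in> snd ` S}. monom 1 (card S))
    = Q2 (int (k - Suc m)) (int (card A))"
proof -
  let ?W = "{V. V \<subseteq> {m..<k} \<and> m \<in> V}"
  have "card {V\<in>?W. card V = j} = (if j = 0 then 0 else (k - Suc m) choose (j - 1))" for j
  proof (cases j)
    case 0
    have "{V\<in>?W. card V = 0} = {}" by (auto simp: card_eq_0_iff dest: finite_subset)
    then show ?thesis unfolding 0 by (simp only: card.empty simp_thms if_True)
  next
    case (Suc i)
    let ?B = "{Suc m..<k}"
    have "bij_betw (insert m) {V. V \<subseteq> ?B \<and> card V = i} {V\<in>?W. card V = j}"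
    proof (rule bij_betw_byWitness[where f' = "\<lambda>V. V - {m}"])
      show "insert m ` {V. V \<subseteq> ?B \<and> card V = i} \<subseteq> {V\<in>?W. card V = j}"
      proof (rule image_subsetI)
        fix V assume V: "V \<in> {V. V \<subseteq> ?B \<and> card V = i}"
        then have "finite V" "m \<notin> V" by (auto intro: finite_subset)
        then show "insert m V \<in> {V\<in>?W. card V = j}" using V assms(2) Suc by auto
      qed
      show "(\<lambda>V. V - {m}) ` {V\<in>?W. card V = j} \<subseteq> {V. V \<subseteq> ?B \<and> card V = i}"
      proof (rule image_subsetI)
        fix V assume V: "V \<in> {V\<in>?W. card V = j}"
        then have "V - {m} \<subseteq> ?B" by (auto simp: Suc_le_eq order.strict_iff_order)
        then show "V - {m} \<in> {V. V \<subseteq> ?B \<and> card V = i}" using V Suc by simp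
      qed
    qed auto
    then have "card {V\<in>?W. card V = j} = card {V. V \<subseteq> ?B \<and> card V = i}"
      by (rule bij_betw_same_card[symmetric])
    also have "\<dots> = (k - Suc m) choose i" by (subst n_subsets) auto
    finally show ?thesis using Suc by simp
  qed
  moreover have "{S. S \<subseteq> A \<times> {m..<k} \<and> strict_chain S \<and> m \<in> snd ` S}
      = {S. S \<subseteq> A \<times> {m..<k} \<and> strict_chain S \<and> snd ` S \<in> ?W}" by auto
  ultimately show ?thesis
    using grid_chain_sum[OF assms(1), of "{m..<k}" ?W] by (simp add: Q2_nat)
qed

text \<open>The height below which a chain must stay to be continued by \<open>S\<close>; for empty \<open>S\<close> this is the
  bound \<open>k\<close> for all heights.\<close>

definition lowest :: "nat \<Rightarrow> (nat \<times> nat) set \<Rightarrow> nat" where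
  "lowest k S = (if S = {} then k else Min (snd ` S))"

lemma lowest_less_iff:
  "finite S \<Longrightarrow> \<forall>q\<in>S. snd q < k \<Longrightarrow> y < lowest k S \<longleftrightarrow> y < k \<and> (\<forall>q\<in>S. y < snd q)"
  by (cases "S = {}") (simp_all add: lowest_def, metis ex_in_conv less_trans)

text \<open>A chain is cut by the line \<open>x = l\<close>. The left part interacts with the right part \<open>T\<close> only
  through the lowest height of \<open>T\<close>, so the left parts that fit \<open>T\<close> are again counted by
  \<open>chain_poly\<close>.\<close>

lemma chain_poly_split:
  assumes X: "finite X"
  shows "chain_poly X k = (\<Sum>T\<in>point_chains {p\<in>X. l \<le> fst p} k.
    monom 1 (card T) * chain_poly {p\<in>X. fst p < l} (lowest k T))"
proof -
  let ?L = "{p\<in>X. fst p < l}" and ?H = "{p\<in>X. l \<le> fst p}"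
  have "chain_poly X k = (\<Sum>(T, S)\<in>(SIGMA T:point_chains ?H k. point_chains ?L (lowest k T)).
      monom 1 (card T) * monom 1 (card S))"
    unfolding chain_poly_def
  proof (rule sum.reindex_bij_witness[symmetric,
        of _ "\<lambda>S. (S \<inter> ?H, S \<inter> ?L)" "\<lambda>(T, S). S \<union> T"], goal_cases)
    case (1 p)
    then show ?case by (auto simp: point_chains_def)
  next
    case (2 p)
    obtain T S where p: "p = (T, S)" "T \<in> point_chains ?H k" "S \<in> point_chains ?L (lowest k T)"
      using 2 by auto
    have fin: "finite T" using p(2) X by (auto simp: point_chains_def intro: finite_subset)
    have low: "snd s < k \<and> (\<forall>q\<in>T. snd s < snd q)" if "s \<in> S" for s
      using p(2,3) that lowest_less_iff[OF fin, of k "snd s"] by (auto simp: point_chains_def)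
    have "strict_chain (S \<union> T)"
      unfolding strict_chain_def
    proof (intro ballI)
      fix a b assume "a \<in> S \<union> T" "b \<in> S \<union> T"
      moreover have "fst s < fst t \<and> snd s < snd t" if "s \<in> S" "t \<in> T" for s t
        using low[OF that(1)] that p(2,3) by (force simp: point_chains_def)
      moreover have "strict_chain S" "strict_chain T" using p by (auto simp: point_chains_def)
      ultimately show "a = b \<or> (fst a < fst b \<and> snd a < snd b) \<or> (fst b < fst a \<and> snd b < snd a)"
        unfolding strict_chain_def by blast
    qed
    then show ?case using p low by (auto simp: point_chains_def)
  next
    case (3 S)
    then show ?case by (auto simp: point_chains_def)
  next
    case (4 S)
    then have S: "S \<subseteq> X" "strict_chain S" "\<forall>p\<in>S. snd p < k" by (auto simp: point_chains_def)
    have fin: "finite (S \<inter> ?H)" using X by simp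
    have "snd s < lowest k (S \<inter> ?H)" if "s \<in> S \<inter> ?L" for s
    proof -
      have "snd s < snd q" if "q \<in> S \<inter> ?H" for q
        using S(2) that \<open>s \<in> S \<inter> ?L\<close> unfolding strict_chain_def by fastforce
      then show ?thesis using lowest_less_iff[OF fin] S(3) that by auto
    qed
    then show ?case using S by (auto simp: point_chains_def intro: strict_chain_subset)
  next
    case (5 p)
    obtain T S where p: "p = (T, S)" "T \<subseteq> ?H" "S \<subseteq> ?L" using 5 by (auto simp: point_chains_def)
    have "finite T" "finite S" using p X by (auto intro: finite_subset)
    moreover have "S \<inter> T = {}" using p(2,3) by fastforce
    ultimately have "card (S \<union> T) = card T + card S" by (simp add: card_Un_disjoint)
    then show ?case by (simp add: p(1) mult_monom)
  qed
  also have "\<dots> = (\<Sum>T\<in>point_chains ?H k. \<Sum>S\<in>point_chains ?L (lowest k T).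
      monom 1 (card T) * monom 1 (card S))"
    using X by (intro sum.Sigma[symmetric]) (auto intro: finite_point_chains)
  finally show ?thesis by (simp add: chain_poly_def sum_distrib_left)
qed

lemma chain_poly_rectangle:
  assumes "1 \<le> k" "k \<le> r" "0 < l"
  shows "chain_poly ({0<..<l} \<times> {1..<r}) k = Q1 (int k - 1) (int l - 1)"
proof -
  have "point_chains ({0<..<l} \<times> {1..<r}) k = {S. S \<subseteq> {0<..<l} \<times> {1..<k} \<and> strict_chain S}"
    using assms(2) by (force simp: point_chains_def)
  then show ?thesis
    using sum_grid_chains[of "{0<..<l}" "{1..<k}"] assms by (simp add: chain_poly_def of_nat_diff)
qed

text \<open>Chains are grouped by the lowest height \<open>m\<close> of their part in the columns \<open>x \<ge> l\<close>. If \<open>m < r\<close>,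
  that part ranges over the grid of width \<open>b\<close>, the line \<open>x = l\<close> included, and the rest stays below
  \<open>m\<close>. Otherwise it avoids the line \<open>x = l\<close>, so the width drops to \<open>b - 1\<close>, and it puts no constraint
  on the rest, whose heights are all less than \<open>r\<close>; for \<open>k \<le> r\<close> it is then empty.\<close>

lemma chain_poly_append_corner:
  fixes l r a b k :: nat
  assumes X: "finite X" "\<And>p. p \<in> X \<Longrightarrow> fst p < l \<and> snd p < r" and r: "1 \<le> r" and b: "0 < b"
    and k: "1 \<le> k" "k \<le> r + a"
  shows "chain_poly (X \<union> {l} \<times> {1..<r} \<union> {l<..<l + b} \<times> {1..<r + a}) k =
    (if k \<le> r then chain_poly X k else chain_poly X r * Q1 (int k - int r) (int b - 1)) +
    (\<Sum>m\<in>{1..min (k - 1) (r - 1)}. chain_poly X m * Q2 (int k - 1 - int m) (int b))"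
proof -
  define Y where "Y = X \<union> {l} \<times> {1..<r} \<union> {l<..<l + b} \<times> {1..<r + a}"
  define H where "H = {l} \<times> {1..<r} \<union> {l<..<l + b} \<times> {1..<r + a}"
  have X2: "\<forall>x y. (x, y) \<in> X \<longrightarrow> x < l" using X(2) by fastforce
  have YL: "{p\<in>Y. fst p < l} = X" and YH: "{p\<in>Y. l \<le> fst p} = H"
    using X2 by (auto simp: Y_def H_def)
  have finY: "finite Y" and finH: "finite H" using X(1) by (auto simp: Y_def H_def)
  let ?F = "point_chains H k"
  let ?t = "\<lambda>T. monom 1 (card T) * chain_poly X (lowest k T)"
  let ?M = "{1..min (k - 1) (r - 1)}"
  let ?G = "{T\<in>?F. min k r \<le> lowest k T}" and ?Fm = "\<lambda>m. {T\<in>?F. lowest k T = m}"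
  have finF: "finite ?F" using finH by (rule finite_point_chains)
  have low: "lowest k T \<in> {1..k}" and low_eq: "T \<noteq> {} \<Longrightarrow> lowest k T \<in> snd ` T \<and> (\<forall>q\<in>T. lowest k T \<le> snd q)"
    if "T \<in> ?F" for T
  proof -
    have fin: "finite T" using that finH by (auto simp: point_chains_def intro: finite_subset)
    show *: "lowest k T \<in> snd ` T \<and> (\<forall>q\<in>T. lowest k T \<le> snd q)" if "T \<noteq> {}"
      using fin that Min_in[of "snd ` T"] by (simp add: lowest_def)
    have "snd q \<in> {1..<k}" if "q \<in> T" for q
      using that \<open>T \<in> ?F\<close> by (auto simp: point_chains_def H_def)
    then show "lowest k T \<in> {1..k}" using * k(1) by (cases "T = {}") (force simp: lowest_def)+
  qed
  have "?F = ?G \<union> (\<Union>m\<in>?M. ?Fm m)" using low by fastforce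
  moreover have "?G \<inter> (\<Union>m\<in>?M. ?Fm m) = {}" using r k by auto
  ultimately have "chain_poly Y k = (\<Sum>T\<in>?G. ?t T) + (\<Sum>T\<in>(\<Union>m\<in>?M. ?Fm m). ?t T)"
    unfolding chain_poly_split[OF finY, of k l] YL YH using finF
    by (metis (no_types, lifting) finite_Un sum.union_disjoint)
  also have "(\<Sum>T\<in>(\<Union>m\<in>?M. ?Fm m). ?t T) = (\<Sum>m\<in>?M. \<Sum>T\<in>?Fm m. ?t T)"
    using finF by (intro sum.UNION_disjoint) auto
  also have "\<dots> = (\<Sum>m\<in>?M. chain_poly X m * Q2 (int k - 1 - int m) (int b))"
  proof (intro sum.cong refl)
    fix m assume m: "m \<in> ?M"
    then have mk: "m < k" "m < r" "1 \<le> m" using k r by auto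
    have "?Fm m = {S. S \<subseteq> {l..<l + b} \<times> {m..<k} \<and> strict_chain S \<and> m \<in> snd ` S}"
    proof (intro equalityI subsetI)
      fix T assume T: "T \<in> ?Fm m"
      then have "T \<noteq> {}" using mk by (auto simp: lowest_def)
      then have "m \<in> snd ` T" "\<forall>q\<in>T. m \<le> snd q" using low_eq[of T] T by auto
      then show "T \<in> {S. S \<subseteq> {l..<l + b} \<times> {m..<k} \<and> strict_chain S \<and> m \<in> snd ` S}"
        using T b by (force simp: point_chains_def H_def)
    next
      fix T assume T: "T \<in> {S. S \<subseteq> {l..<l + b} \<times> {m..<k} \<and> strict_chain S \<and> m \<in> snd ` S}"
      then obtain q where q: "q \<in> T" "snd q = m" by auto
      have bnd: "l \<le> fst p" "fst p < l + b" "m \<le> snd p" "snd p < k" if "p \<in> T" for p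
        using T that by (auto dest: subsetD)
      \<comment> \<open>The line \<open>x = l\<close> can only be met by the lowest point, which is at height \<open>m < r\<close>.\<close>
      have left: "snd p = m" if p: "p \<in> T" "fst p = l" for p
      proof -
        have "p = q \<or> (fst p < fst q \<and> snd p < snd q) \<or> (fst q < fst p \<and> snd q < snd p)"
          using T p(1) q(1) by (auto simp: strict_chain_def)
        then show ?thesis using bnd[OF p(1)] bnd[OF q(1)] p(2) q(2) by auto
      qed
      have "T \<subseteq> H"
      proof
        fix p assume p: "p \<in> T"
        then show "p \<in> H" using left[OF p] bnd[OF p] mk k
          by (cases p; cases "fst p = l") (auto simp: H_def)
      qed
      moreover have "lowest k T = m"
      proof -
        have "finite T" using \<open>T \<subseteq> H\<close> finH by (rule finite_subset)
        then have "Min (snd ` T) = m" using q bnd(3) by (intro Min_eqI) auto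
        then show ?thesis using q by (auto simp: lowest_def)
      qed
      ultimately show "T \<in> ?Fm m" using T bnd(4) by (auto simp: point_chains_def)
    qed
    then have "(\<Sum>T\<in>?Fm m. monom 1 (card T)) = Q2 (int k - 1 - int m) (int b)"
      using sum_grid_chains_min[of "{l..<l + b}" m k] mk(1) by (simp add: of_nat_diff algebra_simps)
    moreover have "(\<Sum>T\<in>?Fm m. ?t T) = (\<Sum>T\<in>?Fm m. monom 1 (card T)) * chain_poly X m"
      unfolding sum_distrib_right by (intro sum.cong refl) simp
    ultimately show "(\<Sum>T\<in>?Fm m. ?t T) = chain_poly X m * Q2 (int k - 1 - int m) (int b)"
      by (simp add: mult.commute)
  qed
  also have "(\<Sum>T\<in>?G. ?t T)
      = (if k \<le> r then chain_poly X k else chain_poly X r * Q1 (int k - int r) (int b - 1))"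
  proof (cases "k \<le> r")
    case True
    have "T = {}" if T: "T \<in> ?G" for T
    proof (rule ccontr)
      assume "T \<noteq> {}"
      then have "lowest k T \<in> snd ` T" using low_eq T by blast
      then show False using T True by (auto simp: point_chains_def)
    qed
    moreover have "{} \<in> ?G" using True by (simp add: point_chains_def strict_chain_def lowest_def)
    ultimately have "?G = {{}}" by blast
    then show ?thesis using True by (simp add: lowest_def)
  next
    case False
    have eq: "chain_poly X m = chain_poly X r" if "r \<le> m" for m
    proof -
      have "point_chains X m = point_chains X r"
        using X(2) that by (fastforce simp: point_chains_def)
      then show ?thesis by (simp add: chain_poly_def)
    qed
    have "?G = {S. S \<subseteq> {l<..<l + b} \<times> {r..<k} \<and> strict_chain S}"
    proof (intro equalityI subsetI)
      fix T assume T: "T \<in> ?G"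
      have "r \<le> snd q" if "q \<in> T" for q
        using low_eq[of T] T that False by fastforce
      then show "T \<in> {S. S \<subseteq> {l<..<l + b} \<times> {r..<k} \<and> strict_chain S}"
        using T by (fastforce simp: point_chains_def H_def)
    next
      fix T assume T: "T \<in> {S. S \<subseteq> {l<..<l + b} \<times> {r..<k} \<and> strict_chain S}"
      then have F: "T \<in> ?F" using r k by (fastforce simp: point_chains_def H_def)
      have "r \<le> lowest k T"
      proof (cases "T = {}")
        case False
        then obtain q where "q \<in> T" "lowest k T = snd q" using low_eq[OF F] by auto
        then show ?thesis using T by auto
      qed (use False in \<open>simp add: lowest_def\<close>)
      then show "T \<in> ?G" using F by simp
    qed
    then have "(\<Sum>T\<in>?G. monom 1 (card T)) = Q1 (int k - int r) (int b - 1)"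
      using sum_grid_chains[of "{l<..<l + b}" "{r..<k}"] False b by (simp add: of_nat_diff)
    moreover have "(\<Sum>T\<in>?G. ?t T) = (\<Sum>T\<in>?G. monom 1 (card T)) * chain_poly X r"
      unfolding sum_distrib_right
    proof (intro sum.cong refl)
      fix T assume "T \<in> ?G"
      then have "chain_poly X (lowest k T) = chain_poly X r" using False by (intro eq) simp
      then show "?t T = monom 1 (card T) * chain_poly X r" by simp
    qed
    ultimately show ?thesis using False by (simp add: mult.commute)
  qed
  finally show ?thesis unfolding Y_def .
qed

section \<open>The recursion\<close>

lemma gbar_eq_weighted_sum:
  assumes E: "ground M \<in> cyclic_flats M" and rk: "0 < rk M (ground M)"
  shows "gbar M k = (\<Sum>C\<in>chains_between (cyclic_flats M) {} (ground M).
    smult (chain_weight (cyclic_flats M) {} (ground M) C) (chain_poly (points_below (chain_path M C)) k))"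
proof -
  let ?Z = "cyclic_flats M" and ?E = "ground M"
  have Z: "?Z \<inter> {{}..?E} = ?Z" using cyclic_flats_subset by fastforce
  show ?thesis
    unfolding gbar_def
  proof (rule sum.cong)
    show "bounded_chains ?Z {} ?E = chains_between ?Z {} ?E" by (simp only: Z)
  next
    fix C assume C: "C \<in> chains_between ?Z {} ?E"
    have "- moebius (chain_lattice ?Z {} ?E) (top.Value C) top.Top = chain_weight ?Z {} ?E C"
      using moebius_chain_lattice_Top[OF finite_cyclic_flats C] by (simp only: Z)
    moreover have "(\<Sum>i<rk M ?E. monom (int (num_chains_below i k (chain_path M C))) i)
        = chain_poly (points_below (chain_path M C)) k"
      using sum_num_chains_below[of "chain_path M C" k] chain_path_ends[OF C] rk by simp
    ultimately show "smult (- moebius (chain_lattice ?Z {} ?E) (top.Value C) top.Top)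
        (\<Sum>i<rk M ?E. monom (int (num_chains_below i k (chain_path M C))) i)
      = smult (chain_weight ?Z {} ?E C) (chain_poly (points_below (chain_path M C)) k)" by simp
  qed
qed

text \<open>The chains, weights and paths of \<open>M|A\<close> are those of the interval from \<open>{}\<close> to \<open>A\<close> in the
  cyclic flats of \<open>M\<close>.\<close>

lemma gbar_restriction:
  assumes A: "A \<in> cyclic_flats M" and rk: "0 < rk M A"
  shows "gbar (restriction M A) k = (\<Sum>C\<in>chains_between (cyclic_flats M) {} A.
    smult (chain_weight (cyclic_flats M) {} A C) (chain_poly (points_below (chain_path M C)) k))"
proof -
  let ?N = "restriction M A"
  have ground: "ground ?N = A" using cyclic_flatsD(1)[OF A] by auto
  have Z: "cyclic_flats ?N = cyclic_flats M \<inter> {{}..A}" by (rule cyclic_flats_restriction[OF A])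
  have ch: "chains_between (cyclic_flats ?N) {} A = chains_between (cyclic_flats M) {} A"
    unfolding Z by (simp only: Int_assoc Int_absorb)
  have w: "chain_weight (cyclic_flats ?N) {} A C = chain_weight (cyclic_flats M) {} A C" for C
    unfolding chain_weight_def ch ..
  have "gbar ?N k = (\<Sum>C\<in>chains_between (cyclic_flats M) {} A.
    smult (chain_weight (cyclic_flats M) {} A C) (chain_poly (points_below (chain_path ?N C)) k))"
    using gbar_eq_weighted_sum[of ?N k] A rk
    unfolding ground ch w by (simp add: Z rk_restriction)
  also have "\<dots> = (\<Sum>C\<in>chains_between (cyclic_flats M) {} A.
    smult (chain_weight (cyclic_flats M) {} A C) (chain_poly (points_below (chain_path M C)) k))"
    by (intro sum.cong refl) (simp add: chain_path_restriction)
  finally show ?thesis .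
qed

lemma smult_sum_right: "smult c (\<Sum>x\<in>A. f x) = (\<Sum>x\<in>A. smult c (f x))"
  by (induction A rule: infinite_finite_induct) (simp_all add: smult_add_right)

text \<open>The contribution of the chains whose last member below the ground set is \<open>A\<close>, up to the factor
  \<open>- \<mu>(A, M)\<close>. The counting identity for one appended corner is linear in the counts below the
  shorter path, hence survives the weighted sum over all chains up to \<open>A\<close>.\<close>

lemma gbar_last_step:
  assumes Z: "{} \<in> cyclic_flats M" "ground M \<in> cyclic_flats M"
    and A: "A \<in> cyclic_flats M" "A \<noteq> {}" "A \<noteq> ground M"
    and k: "1 \<le> k" "k \<le> rk M (ground M)"
  shows "(\<Sum>C\<in>chains_between (cyclic_flats M) {} A. smult (chain_weight (cyclic_flats M) {} A C)
      (chain_poly (points_below (chain_path M (insert (ground M) C))) k)) =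
    (if k \<le> rk M A then gbar (restriction M A) k
     else gbar (restriction M A) (rk M A) *
       Q1 (int k - int (rk M A)) (int (nullity M (ground M)) - int (nullity M A) - 1)) +
    (\<Sum>m\<in>{1..min (k - 1) (rk M A - 1)}. gbar (restriction M A) m *
       Q2 (int k - 1 - int m) (int (nullity M (ground M)) - int (nullity M A)))"
proof -
  let ?Z = "cyclic_flats M" and ?E = "ground M"
  let ?X = "\<lambda>C. points_below (chain_path M C)" and ?w = "chain_weight ?Z {} A"
  let ?q1 = "Q1 (int k - int (rk M A)) (int (nullity M ?E) - int (nullity M A) - 1)"
  let ?q2 = "\<lambda>m. Q2 (int k - 1 - int m) (int (nullity M ?E) - int (nullity M A))"
  have AE: "A \<subset> ?E" using A cyclic_flatsD(1) by blast
  have rkA: "0 < rk M A" using rk_strict_mono_cyclic_flats[OF Z(1) A(1)] A(2) by (simp add: psubset_eq)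
  have rkE: "rk M A < rk M ?E" and nulE: "nullity M A < nullity M ?E"
    using rk_strict_mono_cyclic_flats nullity_strict_mono_cyclic_flats A(1) Z(2) AE by blast+
  have step: "chain_poly (?X (insert ?E C)) k =
      (if k \<le> rk M A then chain_poly (?X C) k else chain_poly (?X C) (rk M A) * ?q1) +
      (\<Sum>m\<in>{1..min (k - 1) (rk M A - 1)}. chain_poly (?X C) m * ?q2 m)"
    if C: "C \<in> chains_between ?Z {} A" for C
  proof -
    note ends = chain_path_ends[OF C]
    have X: "?X (insert ?E C) = ?X C \<union> {nullity M A} \<times> {1..<rk M A} \<union>
        {nullity M A<..<nullity M A + (nullity M ?E - nullity M A)} \<times>
        {1..<rk M A + (rk M ?E - rk M A)}"
      unfolding chain_path_insert_top[OF C AE]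
      using points_below_append_corner[of "chain_path M C"] ends nulE by simp
    have "fst p < nullity M A \<and> snd p < rk M A" if "p \<in> ?X C" for p
      using that ends by (cases p) (auto simp: mem_points_below_iff)
    then show ?thesis unfolding X
      using chain_poly_append_corner[OF finite_points_below, of "chain_path M C" "nullity M A" "rk M A"
          "nullity M ?E - nullity M A" k "rk M ?E - rk M A"] rkA rkE nulE k
      by (simp add: of_nat_diff)
  qed
  have g: "gbar (restriction M A) m = (\<Sum>C\<in>chains_between ?Z {} A. smult (?w C) (chain_poly (?X C) m))"
    for m by (rule gbar_restriction[OF A(1) rkA])
  have "(\<Sum>C\<in>chains_between ?Z {} A. smult (?w C) (chain_poly (?X (insert ?E C)) k))
      = (\<Sum>C\<in>chains_between ?Z {} A.
          (if k \<le> rk M A then smult (?w C) (chain_poly (?X C) k)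
           else smult (?w C) (chain_poly (?X C) (rk M A)) * ?q1) +
          (\<Sum>m\<in>{1..min (k - 1) (rk M A - 1)}. smult (?w C) (chain_poly (?X C) m) * ?q2 m))"
    by (intro sum.cong refl) (simp add: step smult_add_right smult_sum_right)
  also have "\<dots> = (if k \<le> rk M A then gbar (restriction M A) k
       else gbar (restriction M A) (rk M A) * ?q1) +
      (\<Sum>m\<in>{1..min (k - 1) (rk M A - 1)}. gbar (restriction M A) m * ?q2 m)"
    unfolding sum.distrib g sum_distrib_right
    by (subst sum.swap) simp
  finally show ?thesis .
qed

text \<open>Splitting the chains by their last member below the ground set shows that \<open>gbar\<close> satisfies the
  defining equation of \<open>R\<close>; the chain \<open>{} < M\<close> gives the leading term, where the points below the
  path fill a rectangle.\<close>

lemma gbar_recursion: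
  assumes Z: "{} \<in> cyclic_flats M" "ground M \<in> cyclic_flats M" and ne: "ground M \<noteq> {}"
    and k: "1 \<le> k" "k \<le> rk M (ground M)"
  shows "gbar M k =
     smult (- moebius (cyclic_flats M) {} (ground M))
       (Q1 (int k - 1) (int (nullity M (ground M)) - 1))
     - (\<Sum>A\<in>cyclic_flats M - {{}, ground M}.
          smult (moebius (cyclic_flats M) A (ground M))
            ((if k \<le> rk M A then gbar (restriction M A) k
              else gbar (restriction M A) (rk M A) *
                   Q1 (int k - int (rk M A)) (int (nullity M (ground M)) - int (nullity M A) - 1))
             + (\<Sum>m\<in>{1..min (k - 1) (rk M A - 1)}.
                  gbar (restriction M A) m *
                  Q2 (int k - 1 - int m) (int (nullity M (ground M)) - int (nullity M A)))))"
    (is "_ = _ - (\<Sum>A\<in>_. smult _ (?S A))")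
proof -
  let ?Z = "cyclic_flats M" and ?E = "ground M"
  let ?X = "\<lambda>C. points_below (chain_path M C)"
  let ?P = "\<lambda>A. \<Sum>C\<in>chains_between ?Z {} A. smult (chain_weight ?Z {} A C)
      (chain_poly (?X (insert ?E C)) k)"
  have fin: "finite ?Z" by (rule finite_cyclic_flats)
  have "{} < ?E" using ne by auto
  have "gbar M k = (\<Sum>C\<in>chains_between ?Z {} ?E. smult (chain_weight ?Z {} ?E C) (chain_poly (?X C) k))"
    using Z k by (intro gbar_eq_weighted_sum) auto
  also have "\<dots> = (\<Sum>A\<in>{A\<in>?Z. {} \<le> A \<and> A < ?E}. \<Sum>C\<in>chains_between ?Z {} A.
      smult (chain_weight ?Z {} ?E (insert ?E C)) (chain_poly (?X (insert ?E C)) k))"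
    by (rule sum_chains_between_remove_top[OF fin Z(2) \<open>{} < ?E\<close>])
  also have "\<dots> = (\<Sum>A\<in>{A\<in>?Z. {} \<le> A \<and> A < ?E}. smult (- moebius ?Z A ?E) (?P A))"
  proof (intro sum.cong refl)
    fix A assume "A \<in> {A\<in>?Z. {} \<le> A \<and> A < ?E}"
    then have "A < ?E" by simp
    then show "(\<Sum>C\<in>chains_between ?Z {} A.
        smult (chain_weight ?Z {} ?E (insert ?E C)) (chain_poly (?X (insert ?E C)) k))
      = smult (- moebius ?Z A ?E) (?P A)"
      unfolding smult_sum_right
      by (intro sum.cong refl) (simp add: chain_weight_insert_top[OF fin _ Z(2)])
  qed
  also have "{A\<in>?Z. {} \<le> A \<and> A < ?E} = insert {} (?Z - {{}, ?E})"
    using Z ne cyclic_flats_subset by auto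
  also have "(\<Sum>A\<in>insert {} (?Z - {{}, ?E}). smult (- moebius ?Z A ?E) (?P A))
      = smult (- moebius ?Z {} ?E) (?P {}) - (\<Sum>A\<in>?Z - {{}, ?E}. smult (moebius ?Z A ?E) (?P A))"
    using fin by (subst sum.insert) (auto simp: sum_negf)
  also have "(\<Sum>A\<in>?Z - {{}, ?E}. smult (moebius ?Z A ?E) (?P A))
      = (\<Sum>A\<in>?Z - {{}, ?E}. smult (moebius ?Z A ?E) (?S A))"
    using gbar_last_step[OF Z _ _ _ k] by (intro sum.cong refl) simp
  also have "?P {} = Q1 (int k - 1) (int (nullity M ?E) - 1)"
  proof -
    have ch_iff: "C \<in> chains_between ?Z {} {} \<longleftrightarrow> C = {{}}" for C
      unfolding chains_between_iff using Z(1) by (auto simp: chain_def)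
    then have ch: "chains_between ?Z {} {} = {{{}}}" by blast
    have "{D \<in> {{{}}}. {{}} \<subseteq> D} = {{{} :: 'a set}}" by auto
    then have w: "chain_weight ?Z {} {} {{}} = 1"
      unfolding chain_weight_def ch by simp
    have nul: "0 < nullity M ?E"
      using nullity_strict_mono_cyclic_flats[OF Z] \<open>{} < ?E\<close> by (simp add: nullity_def)
    have C: "{{}} \<in> chains_between ?Z {} {}" by (simp only: ch_iff)
    have path: "chain_path M {{}} = []"
      using chain_path_eq[of "[{}]" "{{}}" M] by simp
    have "points_below [] = {}" by (auto simp: points_below_def)
    then have "?X (insert ?E {{}}) = {0<..<nullity M ?E} \<times> {1..<rk M ?E}"
      using points_below_append_corner[of "[]" "nullity M ?E" "rk M ?E"] nul
      unfolding chain_path_insert_top[OF C \<open>{} < ?E\<close>] path by (simp add: nullity_def)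
    then show ?thesis
      unfolding ch using w chain_poly_rectangle[OF k nul] by simp
  qed
  finally show ?thesis .
qed

text \<open>The hypotheses on \<open>M\<close> are phrased through the cyclic flats because in this form they pass to
  the restrictions \<open>M|A\<close>.\<close>

lemma R_eq_gbar:
  assumes "{} \<in> cyclic_flats M" "ground M \<in> cyclic_flats M" "ground M \<noteq> {}"
    and "1 \<le> k" "k \<le> rk M (ground M)"
  shows "R M k = gbar M k"
  using assms
proof (induction "card (ground M)" arbitrary: M k rule: less_induct)
  case less
  let ?Z = "cyclic_flats M" and ?E = "ground M"
  have IH: "R (restriction M A) m = gbar (restriction M A) m"
    if A: "A \<in> ?Z - {{}, ?E}" and m: "1 \<le> m" "m \<le> rk M A" for A m
  proof (rule less.hyps)
    have g: "ground (restriction M A) = A" using A cyclic_flatsD(1)[of A M] by auto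
    have "A \<subset> ?E" using A cyclic_flatsD(1)[of A M] by auto
    then show "card (ground (restriction M A)) < card ?E"
      unfolding g using finite_ground by (rule psubset_card_mono[rotated])
    show "{} \<in> cyclic_flats (restriction M A)"
      "ground (restriction M A) \<in> cyclic_flats (restriction M A)"
      using A less.prems(1) cyclic_flats_restriction[of A M] unfolding g by auto
    show "ground (restriction M A) \<noteq> {}" using A unfolding g by simp
    show "1 \<le> m" by fact
    show "m \<le> rk (restriction M A) (ground (restriction M A))"
      using m(2) unfolding g by (simp add: rk_restriction)
  qed
  have rk: "1 \<le> rk M A" if "A \<in> ?Z - {{}, ?E}" for A
  proof -
    have "{} \<subset> A" "A \<in> ?Z" using that by auto
    then show ?thesis using rk_strict_mono_cyclic_flats[OF less.prems(1)] by fastforce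
  qed
  show ?case
    unfolding R.simps[of M k] gbar_recursion[OF less.prems]
    using less.prems(4) rk
    by (intro arg_cong2[of _ _ _ _ "(-)"] refl sum.cong arg_cong2[of _ _ _ _ smult]
        arg_cong2[of _ _ _ _ "(+)"] arg_cong2[of _ _ _ _ "(*)"] if_cong IH) auto
qed

theorem proposition3p24:
  fixes M :: "'a matroid" and k :: nat
  assumes "ground M \<noteq> {}"
    and "\<forall>e. \<not> loop M e"
    and "\<forall>e. \<not> coloop M e"
    and "1 \<le> k" and "k \<le> rk M (ground M)"
  shows "R M k = gbar M k"
  using assms by (intro R_eq_gbar empty_mem_cyclic_flats ground_mem_cyclic_flats)

end
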